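(* Let $(M,\rho)$ be a complete Riemannian manifold and let $A$ be a bounded subset of $M$. Put $R_A=\frac14\inf_{a\in A}\mathrm{inj}_aM$. Suppose there exists $C_1(A)\in[1,\infty)$ such that $\mathrm{Card}\,\mathcal{B}\leqslant C_1(A)$ for every Besicovitch family $\mathcal{B}=\{B(x_i,r_i)\}$ in $(M,\rho)$ all of whose balls satisfy $x_i\in A$ and $0<r_i\leqslant R_A$. Let $C_0(A)$ denote the largest cardinality of a strict $r$-net in $B(x,4r)$, over all $x\in A$ and all $0<r<R_A$, and set $C_2(A)=C_1(A)\cdot C_0(A)+1$. Then for every collection $\mathcal{F}$ of geodesic balls $B(x,r)$ with $x\in A$ and $0<r\leqslant R_A$, with $S$ denoting the set of centers of the balls in $\mathcal{F}$, there is a subcollection $\mathcal{F}'\subset\mathcal{F}$ such that $$\chi_S\leqslant\sum_{B\in\mathcal{F}'}\chi_B\leqslant C_2(A).$$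
   Context: $\rho$ is the Riemannian distance on $M$ ($M$ connected). $B(x,r)=\{y\in M:\rho(x,y)\leqslant r\}$ is the closed metric (geodesic) ball with center $x$ and radius $r>0$; a ball is understood together with its center and radius. $\mathrm{inj}_xM$ is the injectivity radius of $M$ at $x$. $\chi_E$ denotes the characteristic function of a set $E$. A finite collection of balls $\mathcal{B}=\{B(x_i,r_i)\}_{i=1}^n$ is a Besicovitch family if $\bigcap_{i=1}^nB(x_i,r_i)\neq\emptyset$ and for every pair of distinct balls $B(x_i,r_i),B(x_j,r_j)\in\mathcal{B}$ one has $x_j\notin B(x_i,r_i)$ and $x_i\notin B(x_j,r_j)$. A strict $r$-net in a set $Y$ is a subset $P\subset Y$ such that $\rho(p,q)>r$ for all distinct $p,q\in P$. *)

theory Defs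
  imports "HOL-Analysis.Analysis"
begin

section \<open>Smooth maps between open subsets of normed spaces\<close>

text \<open>Only meaningful on open sets, since derivatives are two-sided.\<close>

primrec Ck_on :: "nat \<Rightarrow> ('e::real_normed_vector \<Rightarrow> 'f::real_normed_vector) \<Rightarrow> 'e set \<Rightarrow> bool" where
  "Ck_on 0 f S \<longleftrightarrow> continuous_on S f"
| "Ck_on (Suc k) f S \<longleftrightarrow> (\<forall>x\<in>S. f differentiable (at x)) \<and>
     (\<forall>v. Ck_on k (\<lambda>x. frechet_derivative f (at x) v) S)"

definition smooth_on :: "('e::real_normed_vector \<Rightarrow> 'f::real_normed_vector) \<Rightarrow> 'e set \<Rightarrow> bool" where
  "smooth_on f S \<longleftrightarrow> (\<forall>k. Ck_on k f S)"


section \<open>Riemannian manifolds\<close>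

type_synonym ('a, 'e) chart = "'a set \<times> ('a \<Rightarrow> 'e)"

text \<open>The Riemannian metric is given by its coordinate expressions: \<open>metric M c p\<close> is the inner
  product that the chart \<open>c\<close> induces on the model space from the one on the tangent space at
  \<open>p\<close>. The expressions in different charts are related by the tensor transformation law.\<close>

record ('a, 'e) riemannian =
  topol :: "'a topology"
  atlas :: "('a, 'e) chart set"
  metric :: "('a, 'e) chart \<Rightarrow> 'a \<Rightarrow> 'e \<Rightarrow> 'e \<Rightarrow> real"

definition points :: "('a, 'e, 'm) riemannian_scheme \<Rightarrow> 'a set" where
  "points M = topspace (topol M)"

definition is_chart :: "'a topology \<Rightarrow> ('a, 'e::euclidean_space) chart \<Rightarrow> bool" where
  "is_chart X c \<longleftrightarrow> openin X (fst c) \<and> open (snd c ` fst c) \<and>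
     homeomorphic_map (subtopology X (fst c)) (top_of_set (snd c ` fst c)) (snd c)"

definition param :: "('a, 'e) chart \<Rightarrow> 'e \<Rightarrow> 'a" where
  "param c = inv_into (fst c) (snd c)"

definition transition :: "('a, 'e) chart \<Rightarrow> ('a, 'e) chart \<Rightarrow> 'e \<Rightarrow> 'e" where
  "transition c d = snd d \<circ> param c"

definition inner_product :: "('e::real_vector \<Rightarrow> 'e \<Rightarrow> real) \<Rightarrow> bool" where
  "inner_product h \<longleftrightarrow> (\<forall>v. linear (h v)) \<and> (\<forall>v w. h v w = h w v) \<and> (\<forall>v. v \<noteq> 0 \<longrightarrow> h v v > 0)"

locale riemannian_manifold =
  fixes M :: "('a, 'e::euclidean_space, 'm) riemannian_scheme"
  assumes Hausdorff: "Hausdorff_space (topol M)"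
    and second_countable: "second_countable (topol M)"
    and connected: "connected_space (topol M)"
    and chart: "c \<in> atlas M \<Longrightarrow> is_chart (topol M) c"
    and cover: "(\<Union>c\<in>atlas M. fst c) = points M"
    and smooth_transition: "\<lbrakk>c \<in> atlas M; d \<in> atlas M\<rbrakk> \<Longrightarrow>
      smooth_on (transition c d) (snd c ` (fst c \<inter> fst d))"
    and metric_inner: "\<lbrakk>c \<in> atlas M; p \<in> fst c\<rbrakk> \<Longrightarrow> inner_product (metric M c p)"
    and metric_smooth: "c \<in> atlas M \<Longrightarrow>
      smooth_on (\<lambda>x. metric M c (param c x) v w) (snd c ` fst c)"
    and metric_transition: "\<lbrakk>c \<in> atlas M; d \<in> atlas M; p \<in> fst c; p \<in> fst d\<rbrakk> \<Longrightarrow>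
      metric M c p v w = metric M d p
        (frechet_derivative (transition c d) (at (snd c p)) v)
        (frechet_derivative (transition c d) (at (snd c p)) w)"


section \<open>The Riemannian distance\<close>

text \<open>A tangent vector at \<open>p\<close> is represented by its coordinates in the fixed chart
  \<open>chart_at M p\<close>.\<close>

definition chart_at :: "('a, 'e, 'm) riemannian_scheme \<Rightarrow> 'a \<Rightarrow> ('a, 'e) chart" where
  "chart_at M p = (SOME c. c \<in> atlas M \<and> p \<in> fst c)"

definition tnorm :: "('a, 'e, 'm) riemannian_scheme \<Rightarrow> 'a \<Rightarrow> 'e \<Rightarrow> real" where
  "tnorm M p v = sqrt (metric M (chart_at M p) p v v)"

definition velocity :: "('a, 'e::real_normed_vector, 'm) riemannian_scheme \<Rightarrow> (real \<Rightarrow> 'a) \<Rightarrow> real \<Rightarrow> 'e" where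
  "velocity M \<gamma> t = vector_derivative (snd (chart_at M (\<gamma> t)) \<circ> \<gamma>) (at t)"

definition speed :: "('a, 'e::real_normed_vector, 'm) riemannian_scheme \<Rightarrow> (real \<Rightarrow> 'a) \<Rightarrow> real \<Rightarrow> real" where
  "speed M \<gamma> t = tnorm M (\<gamma> t) (velocity M \<gamma> t)"

definition piecewise_C1_curve :: "('a, 'e::real_normed_vector, 'm) riemannian_scheme \<Rightarrow> (real \<Rightarrow> 'a) \<Rightarrow> bool" where
  "piecewise_C1_curve M \<gamma> \<longleftrightarrow> pathin (topol M) \<gamma> \<and>
     (\<forall>c\<in>atlas M. \<forall>a b. 0 \<le> a \<and> a \<le> b \<and> b \<le> 1 \<and> \<gamma> ` {a..b} \<subseteq> fst c \<longrightarrow>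
        (snd c \<circ> \<gamma>) piecewise_C1_differentiable_on {a..b})"

definition curve_of_length :: "('a, 'e::real_normed_vector, 'm) riemannian_scheme \<Rightarrow> 'a \<Rightarrow> 'a \<Rightarrow> (real \<Rightarrow> 'a) \<Rightarrow> real \<Rightarrow> bool" where
  "curve_of_length M p q \<gamma> l \<longleftrightarrow> piecewise_C1_curve M \<gamma> \<and> \<gamma> 0 = p \<and> \<gamma> 1 = q \<and>
     (speed M \<gamma> has_integral l) {0..1}"

text \<open>Distances to objects that are not points of \<open>M\<close> are set to \<open>0\<close>, because
  \<^locale>\<open>Metric_space\<close> requires the distance function to be nonnegative everywhere.\<close>

definition rdist :: "('a, 'e::real_normed_vector, 'm) riemannian_scheme \<Rightarrow> 'a \<Rightarrow> 'a \<Rightarrow> real" where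
  "rdist M p q = (if p \<in> points M \<and> q \<in> points M
     then Inf {l. \<exists>\<gamma>. curve_of_length M p q \<gamma> l} else 0)"


section \<open>Geodesics, the exponential map and the injectivity radius\<close>

text \<open>Christoffel symbols of the first kind, as a trilinear form in the coordinates of \<open>c\<close>.\<close>

definition metric_deriv :: "('a, 'e::real_normed_vector, 'm) riemannian_scheme \<Rightarrow> ('a, 'e) chart \<Rightarrow> 'a \<Rightarrow> 'e \<Rightarrow> 'e \<Rightarrow> 'e \<Rightarrow> real" where
  "metric_deriv M c p u v w =
     frechet_derivative (\<lambda>x. metric M c (param c x) v w) (at (snd c p)) u"

definition christoffel1 :: "('a, 'e::real_normed_vector, 'm) riemannian_scheme \<Rightarrow> ('a, 'e) chart \<Rightarrow> 'a \<Rightarrow> 'e \<Rightarrow> 'e \<Rightarrow> 'e \<Rightarrow> real" where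
  "christoffel1 M c p u v w =
     (metric_deriv M c p u v w + metric_deriv M c p v u w - metric_deriv M c p w u v) / 2"

text \<open>The geodesic equation \<open>x'' + \<Gamma>(x', x') = 0\<close> in every chart, with its free index lowered.\<close>

definition geodesic_on :: "('a, 'e::real_normed_vector, 'm) riemannian_scheme \<Rightarrow> real set \<Rightarrow> (real \<Rightarrow> 'a) \<Rightarrow> bool" where
  "geodesic_on M I \<gamma> \<longleftrightarrow> continuous_map (top_of_set I) (topol M) \<gamma> \<and>
     (\<forall>c\<in>atlas M. \<forall>t\<in>I. \<gamma> t \<in> fst c \<longrightarrow>
       (\<exists>x' x''. (\<forall>\<^sub>F s in nhds t. ((snd c \<circ> \<gamma>) has_vector_derivative x' s) (at s)) \<and>
          (x' has_vector_derivative x'') (at t) \<and>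
          (\<forall>w. metric M c (\<gamma> t) x'' w + christoffel1 M c (\<gamma> t) (x' t) (x' t) w = 0)))"

definition is_rexp :: "('a, 'e::real_normed_vector, 'm) riemannian_scheme \<Rightarrow> 'a \<Rightarrow> 'e \<Rightarrow> 'a \<Rightarrow> bool" where
  "is_rexp M p v q \<longleftrightarrow> (\<exists>I \<gamma>. open I \<and> is_interval I \<and> {0..1} \<subseteq> I \<and> geodesic_on M I \<gamma> \<and>
     \<gamma> 0 = p \<and> velocity M \<gamma> 0 = v \<and> \<gamma> 1 = q)"

definition rexp :: "('a, 'e::real_normed_vector, 'm) riemannian_scheme \<Rightarrow> 'a \<Rightarrow> 'e \<Rightarrow> 'a" where
  "rexp M p v = (THE q. is_rexp M p v q)"

definition diffeo_onto_image :: "('a, 'e::real_normed_vector, 'm) riemannian_scheme \<Rightarrow> 'e set \<Rightarrow> ('e \<Rightarrow> 'a) \<Rightarrow> bool" where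
  "diffeo_onto_image M V f \<longleftrightarrow> open V \<and> inj_on f V \<and> openin (topol M) (f ` V) \<and>
     continuous_map (top_of_set V) (topol M) f \<and>
     (\<forall>c\<in>atlas M. smooth_on (snd c \<circ> f) {v \<in> V. f v \<in> fst c} \<and>
        smooth_on (inv_into V f \<circ> param c) (snd c ` (fst c \<inter> f ` V)))"

definition inj_radius :: "('a, 'e::real_normed_vector, 'm) riemannian_scheme \<Rightarrow> 'a \<Rightarrow> ennreal" where
  "inj_radius M p = Sup {ennreal r | r. 0 < r \<and>
     (\<forall>v\<in>{v. tnorm M p v < r}. \<exists>q. is_rexp M p v q) \<and>
     diffeo_onto_image M {v. tnorm M p v < r} (rexp M p)}"


section \<open>Balls, Besicovitch families and nets\<close>

text \<open>\<open>rball M x r\<close> is a closed ball. As an object with a center and a radius, a ball is represented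
  by the pair of its center and radius.\<close>

abbreviation rball :: "('a, 'e::real_normed_vector, 'm) riemannian_scheme \<Rightarrow> 'a \<Rightarrow> real \<Rightarrow> 'a set" where
  "rball M \<equiv> Metric_space.mcball (points M) (rdist M)"

definition besicovitch_family :: "('a, 'e::real_normed_vector, 'm) riemannian_scheme \<Rightarrow> ('a \<times> real) set \<Rightarrow> bool" where
  "besicovitch_family M B \<longleftrightarrow> finite B \<and> (\<Inter>(x, r)\<in>B. rball M x r) \<noteq> {} \<and>
     (\<forall>(x, r)\<in>B. \<forall>(y, s)\<in>B. (x, r) \<noteq> (y, s) \<longrightarrow> y \<notin> rball M x r \<and> x \<notin> rball M y s)"

definition strict_net :: "('a, 'e::real_normed_vector, 'm) riemannian_scheme \<Rightarrow> real \<Rightarrow> 'a set \<Rightarrow> 'a set \<Rightarrow> bool" where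
  "strict_net M r Y P \<longleftrightarrow> P \<subseteq> Y \<and> (\<forall>p\<in>P. \<forall>q\<in>P. p \<noteq> q \<longrightarrow> rdist M p q > r)"

definition R_bound :: "('a, 'e::real_normed_vector, 'm) riemannian_scheme \<Rightarrow> 'a set \<Rightarrow> ennreal" where
  "R_bound M A = (INF a\<in>A. inj_radius M a) / 4"

text \<open>The largest cardinality of a net, as a supremum in \<open>[0, \<infinity>]\<close>; the counting measure gives
  the cardinality of a set, with value \<open>\<infinity>\<close> on infinite sets.\<close>

definition C0 :: "('a, 'e::real_normed_vector, 'm) riemannian_scheme \<Rightarrow> 'a set \<Rightarrow> ennreal" where
  "C0 M A = Sup {emeasure (count_space UNIV) P | P x r.
     x \<in> A \<and> 0 < r \<and> ennreal r < R_bound M A \<and> strict_net M r (rball M x (4 * r)) P}"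

definition admissible_balls :: "('a, 'e::real_normed_vector, 'm) riemannian_scheme \<Rightarrow> 'a set \<Rightarrow> ('a \<times> real) set" where
  "admissible_balls M A = {(x, r). x \<in> A \<and> 0 < r \<and> ennreal r \<le> R_bound M A}"


section \<open>The Riemannian distance is a metric\<close>


lemma smooth_onD:
  assumes "smooth_on f S"
  shows "continuous_on S f" "x \<in> S \<Longrightarrow> f differentiable (at x)"
    "continuous_on S (\<lambda>x. frechet_derivative f (at x) v)"
proof -
  have "Ck_on 0 f S" "Ck_on (Suc 0) f S"
    using assms by (auto simp only: smooth_on_def)
  then show "continuous_on S f" "x \<in> S \<Longrightarrow> f differentiable (at x)"
    "continuous_on S (\<lambda>x. frechet_derivative f (at x) v)" by auto
qed

lemma piecewise_C1_differentiable_cong: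
  fixes f g :: "real \<Rightarrow> 'e::real_normed_vector"
  assumes "f piecewise_C1_differentiable_on {a..b}" "\<And>x. x \<in> {a..b} \<Longrightarrow> f x = g x"
  shows "g piecewise_C1_differentiable_on {a..b}"
proof -
  obtain S D where f: "continuous_on {a..b} f" "finite S"
    "\<And>x. x \<in> {a..b} - S \<Longrightarrow> (f has_vector_derivative D x) (at x)" "continuous_on ({a..b} - S) D"
    using assms(1) unfolding piecewise_C1_differentiable_on_def C1_differentiable_on_def by blast
  have "g C1_differentiable_on ({a..b} - insert a (insert b S))"
    unfolding C1_differentiable_on_def
  proof (intro exI conjI ballI)
    fix x assume x: "x \<in> {a..b} - insert a (insert b S)"
    then show "(g has_vector_derivative D x) (at x)"
      by (intro has_vector_derivative_transform_within_open[OF f(3), of x "{a<..<b}"])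
         (use assms(2) in auto)
  next
    show "continuous_on ({a..b} - insert a (insert b S)) D"
      using f(4) by (rule continuous_on_subset) auto
  qed
  moreover have "continuous_on {a..b} g"
    using f(1) assms(2) by (rule continuous_on_eq)
  ultimately show ?thesis
    using f(2) unfolding piecewise_C1_differentiable_on_def by (metis finite_insert)
qed

lemma pathin_local:
  assumes "pathin X \<gamma>" "openin X W" "t \<in> {0..1}" "\<gamma> t \<in> W"
  obtains \<delta> where "\<delta> > 0" "\<And>s. s \<in> {0..1} \<Longrightarrow> \<bar>s - t\<bar> < \<delta> \<Longrightarrow> \<gamma> s \<in> W"
proof -
  have "openin (top_of_set {0..1}) {s \<in> {0..1}. \<gamma> s \<in> W}"
    using assms(1,2) openin_continuous_map_preimage[of "top_of_set {0..1::real}" X \<gamma> W]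
    by (simp add: pathin_def)
  then have "\<exists>e>0. \<forall>s\<in>{0..1}. dist s t < e \<longrightarrow> s \<in> {s \<in> {0..1}. \<gamma> s \<in> W}"
    using assms(3,4) unfolding openin_euclidean_subtopology_iff by auto
  then show ?thesis using that by (auto simp: dist_real_def)
qed

lemma pathin_eventually:
  assumes "pathin X \<gamma>" "openin X W" "t \<in> {0<..<1}" "\<gamma> t \<in> W"
  shows "\<forall>\<^sub>F s in nhds t. \<gamma> s \<in> W"
proof -
  obtain \<delta> where "\<delta> > 0" and \<delta>: "\<And>s. s \<in> {0..1} \<Longrightarrow> \<bar>s - t\<bar> < \<delta> \<Longrightarrow> \<gamma> s \<in> W"
    using pathin_local[OF assms(1,2) _ assms(4)] assms(3) by auto
  have "open ({0<..<1} \<inter> ball t \<delta>)" "t \<in> {0<..<1} \<inter> ball t \<delta>"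
    using \<open>\<delta> > 0\<close> assms(3) by auto
  moreover have "\<gamma> s \<in> W" if "s \<in> {0<..<1} \<inter> ball t \<delta>" for s
    using that \<delta>[of s] by (auto simp: dist_real_def)
  ultimately show ?thesis unfolding eventually_nhds by blast
qed

lemma inner_product_posdef: "inner_product h \<Longrightarrow> h v v \<ge> 0 \<and> (h v v = 0 \<longleftrightarrow> v = 0)"
  unfolding inner_product_def by (metis less_eq_real_def linear_0 order_less_irrefl)

lemma inner_product_scaleR: "inner_product h \<Longrightarrow> h (m *\<^sub>R v) (m *\<^sub>R v) = m\<^sup>2 * h v v"
  unfolding inner_product_def by (metis linear_cmul power2_eq_square real_scaleR_def mult.assoc)

context riemannian_manifold
begin

lemma chartD:
  assumes "c \<in> atlas M"
  shows "openin (topol M) (fst c)" "open (snd c ` fst c)" "inj_on (snd c) (fst c)"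
    "continuous_map (subtopology (topol M) (fst c)) (top_of_set (snd c ` fst c)) (snd c)"
    "continuous_map (top_of_set (snd c ` fst c)) (topol M) (param c)"
    "p \<in> fst c \<Longrightarrow> param c (snd c p) = p"
    "x \<in> snd c ` fst c \<Longrightarrow> snd c (param c x) = x"
    "x \<in> snd c ` fst c \<Longrightarrow> param c x \<in> fst c"
    "fst c \<subseteq> points M"
proof -
  have c: "openin (topol M) (fst c)" "open (snd c ` fst c)"
    "homeomorphic_map (subtopology (topol M) (fst c)) (top_of_set (snd c ` fst c)) (snd c)"
    using chart[OF assms] unfolding is_chart_def by auto
  show "openin (topol M) (fst c)" "open (snd c ` fst c)" by fact+
  show sub: "fst c \<subseteq> points M" using c(1) by (simp add: openin_subset points_def)
  then have ts: "topspace (subtopology (topol M) (fst c)) = fst c"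
    by (auto simp: points_def)
  show inj: "inj_on (snd c) (fst c)"
    using c(3) ts by (simp add: homeomorphic_map_def)
  show "continuous_map (subtopology (topol M) (fst c)) (top_of_set (snd c ` fst c)) (snd c)"
    using c(3) homeomorphic_imp_continuous_map by blast
  obtain g where g: "homeomorphic_maps (subtopology (topol M) (fst c)) (top_of_set (snd c ` fst c)) (snd c) g"
    using c(3) homeomorphic_map_maps by blast
  have eq: "g x = param c x" if "x \<in> snd c ` fst c" for x
    using that g inj ts by (auto simp: homeomorphic_maps_def param_def)
  have "continuous_map (top_of_set (snd c ` fst c)) (subtopology (topol M) (fst c)) g"
    using g by (simp add: homeomorphic_maps_def)
  then have "continuous_map (top_of_set (snd c ` fst c)) (topol M) g"
    by (simp add: continuous_map_in_subtopology)
  then show "continuous_map (top_of_set (snd c ` fst c)) (topol M) (param c)"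
    by (rule continuous_map_eq) (use eq in auto)
  show "p \<in> fst c \<Longrightarrow> param c (snd c p) = p" using inj by (simp add: param_def)
  show "x \<in> snd c ` fst c \<Longrightarrow> snd c (param c x) = x" by (simp add: param_def f_inv_into_f)
  show "x \<in> snd c ` fst c \<Longrightarrow> param c x \<in> fst c" by (simp add: param_def inv_into_into)
qed

lemma chart_at:
  assumes "p \<in> points M" shows "chart_at M p \<in> atlas M" "p \<in> fst (chart_at M p)"
proof -
  have "\<exists>c. c \<in> atlas M \<and> p \<in> fst c" using assms cover by blast
  from someI_ex[OF this] show "chart_at M p \<in> atlas M" "p \<in> fst (chart_at M p)"
    by (auto simp: chart_at_def)
qed

lemma tnorm_nonneg: "p \<in> points M \<Longrightarrow> 0 \<le> tnorm M p v"
  by (simp add: tnorm_def chart_at metric_inner inner_product_posdef)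

lemma tnorm_scaleR: "p \<in> points M \<Longrightarrow> tnorm M p (m *\<^sub>R v) = \<bar>m\<bar> * tnorm M p v"
  by (simp add: tnorm_def chart_at metric_inner inner_product_scaleR real_sqrt_mult)

lemma change_chart:
  assumes c: "c \<in> atlas M" and d: "d \<in> atlas M"
    and ev: "\<forall>\<^sub>F s in nhds t. \<gamma> s \<in> fst c" "\<forall>\<^sub>F s in nhds t. \<gamma> s \<in> fst d"
    and v: "((snd c \<circ> \<gamma>) has_vector_derivative v) (at t)"
  shows "((snd d \<circ> \<gamma>) has_vector_derivative
     frechet_derivative (transition c d) (at (snd c (\<gamma> t))) v) (at t)"
proof -
  have t: "\<gamma> t \<in> fst c" "\<gamma> t \<in> fst d" using ev eventually_nhds_x_imp_x by fast+
  let ?D = "frechet_derivative (transition c d) (at (snd c (\<gamma> t)))"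
  have "transition c d differentiable (at (snd c (\<gamma> t)))"
    using smooth_onD(2)[OF smooth_transition[OF c d]] t by blast
  then have D: "(transition c d has_derivative ?D) (at (snd c (\<gamma> t)))"
    by (simp add: frechet_derivative_works)
  have "((transition c d \<circ> (snd c \<circ> \<gamma>)) has_vector_derivative ?D v) (at t)"
    using vector_derivative_diff_chain_within[OF v, of "transition c d" ?D] has_derivative_at_withinI[OF D]
    by simp
  moreover have "\<forall>\<^sub>F s in nhds t. s \<in> UNIV \<longrightarrow> (transition c d \<circ> (snd c \<circ> \<gamma>)) s = (snd d \<circ> \<gamma>) s"
    using ev(1) by eventually_elim (simp add: transition_def chartD(6)[OF c])
  ultimately show ?thesis
    using t by (subst (asm) has_vector_derivative_cong_ev) (auto simp: transition_def chartD(6)[OF c])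
qed

lemma speed_chart:
  assumes c: "c \<in> atlas M" and \<gamma>: "pathin (topol M) \<gamma>" "t \<in> {0<..<1}" "\<gamma> t \<in> fst c"
    and v: "((snd c \<circ> \<gamma>) has_vector_derivative v) (at t)"
  shows "speed M \<gamma> t = sqrt (metric M c (\<gamma> t) v v)"
    and "(snd (chart_at M (\<gamma> t)) \<circ> \<gamma>) differentiable (at t)"
proof -
  let ?d = "chart_at M (\<gamma> t)"
  have d: "?d \<in> atlas M" "\<gamma> t \<in> fst ?d" using \<gamma>(3) chartD(9)[OF c] chart_at by blast+
  have D: "((snd ?d \<circ> \<gamma>) has_vector_derivative
      frechet_derivative (transition c ?d) (at (snd c (\<gamma> t))) v) (at t)"
    by (rule change_chart[OF c d(1) _ _ v];
        rule pathin_eventually[OF \<gamma>(1) _ \<gamma>(2)]; use c d \<gamma>(3) chartD(1) in blast)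
  then show "(snd ?d \<circ> \<gamma>) differentiable (at t)"
    using differentiableI_vector by blast
  show "speed M \<gamma> t = sqrt (metric M c (\<gamma> t) v v)"
    using vector_derivative_at[OF D] metric_transition[OF c d(1) \<gamma>(3) d(2)]
    by (simp add: speed_def tnorm_def velocity_def)
qed

lemma curve_differentiable:
  assumes "piecewise_C1_curve M \<gamma>"
  obtains S where "finite S" "\<And>t. t \<in> {0..1} - S \<Longrightarrow> (snd (chart_at M (\<gamma> t)) \<circ> \<gamma>) differentiable (at t)"
proof -
  have path: "pathin (topol M) \<gamma>" using assms by (simp add: piecewise_C1_curve_def)
  define P where "P a b \<longleftrightarrow> (0 \<le> a \<longrightarrow> a \<le> b \<longrightarrow> b \<le> 1 \<longrightarrow> (\<exists>S. finite S \<and>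
    (\<forall>t\<in>{a..b} - S. (snd (chart_at M (\<gamma> t)) \<circ> \<gamma>) differentiable (at t))))" for a b :: real
  have "(0::real) \<le> 1" by simp
  then have "P 0 1"
  proof (induction rule: Bolzano)
    case (trans a b e)
    show ?case unfolding P_def
    proof (intro impI)
      assume "0 \<le> a" "a \<le> e" "e \<le> 1"
      then obtain S T where "finite S" "finite T"
        "\<forall>t\<in>{a..b} - S. (snd (chart_at M (\<gamma> t)) \<circ> \<gamma>) differentiable (at t)"
        "\<forall>t\<in>{b..e} - T. (snd (chart_at M (\<gamma> t)) \<circ> \<gamma>) differentiable (at t)"
        using trans unfolding P_def by auto
      then show "\<exists>S. finite S \<and> (\<forall>t\<in>{a..e} - S. (snd (chart_at M (\<gamma> t)) \<circ> \<gamma>) differentiable (at t))"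
        by (intro exI[of _ "S \<union> T"] conjI finite_UnI ballI) (metis DiffD1 DiffD2 DiffI UnCI atLeastAtMost_iff linear)+
    qed
  next
    case (local x)
    have "\<gamma> x \<in> points M" using path local path_image_subset_topspace[OF path] by (auto simp: points_def Pi_iff)
    then obtain c where c: "c \<in> atlas M" "\<gamma> x \<in> fst c" using chart_at by blast
    obtain \<delta> where "\<delta> > 0" and \<delta>: "\<And>s. s \<in> {0..1} \<Longrightarrow> \<bar>s - x\<bar> < \<delta> \<Longrightarrow> \<gamma> s \<in> fst c"
      using pathin_local[OF path chartD(1)[OF c(1)] _ c(2)] local by auto
    have "P a b" if "a \<le> x" "x \<le> b" "b - a < \<delta>" for a b
      unfolding P_def
    proof (intro impI)
      assume ab: "0 \<le> a" "a \<le> b" "b \<le> 1"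
      have sub: "\<gamma> ` {a..b} \<subseteq> fst c" using that ab by (auto intro!: \<delta>)
      then have "(snd c \<circ> \<gamma>) piecewise_C1_differentiable_on {a..b}"
        using assms c ab unfolding piecewise_C1_curve_def by blast
      then obtain S where S: "finite S" "(snd c \<circ> \<gamma>) C1_differentiable_on ({a..b} - S)"
        unfolding piecewise_C1_differentiable_on_def by blast
      have "(snd (chart_at M (\<gamma> t)) \<circ> \<gamma>) differentiable (at t)"
        if t: "t \<in> {a..b} - (S \<union> {a, b})" for t
      proof -
        obtain v where "((snd c \<circ> \<gamma>) has_vector_derivative v) (at t)"
          using S(2) t unfolding C1_differentiable_on_def by blast
        then show ?thesis using t ab sub by (intro speed_chart(2)[OF c(1) path]) auto
      qed
      then show "\<exists>S. finite S \<and> (\<forall>t\<in>{a..b} - S. (snd (chart_at M (\<gamma> t)) \<circ> \<gamma>) differentiable (at t))"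
        using S(1) by (intro exI[of _ "S \<union> {a, b}"]) auto
    qed
    then show ?case using \<open>\<delta> > 0\<close> by blast
  qed
  then show ?thesis using that unfolding P_def by auto
qed

lemma speed_affine:
  assumes "(snd (chart_at M (\<gamma> (m * t + k))) \<circ> \<gamma>) differentiable (at (m * t + k))"
    "\<gamma> (m * t + k) \<in> points M"
  shows "speed M (\<lambda>t. \<gamma> (m * t + k)) t = \<bar>m\<bar> * speed M \<gamma> (m * t + k)"
proof -
  let ?f = "snd (chart_at M (\<gamma> (m * t + k))) \<circ> \<gamma>"
  have f: "(?f has_vector_derivative vector_derivative ?f (at (m * t + k))) (at (m * t + k))"
    using assms(1) vector_derivative_works by blast
  have g: "((\<lambda>t. m * t + k) has_vector_derivative m) (at t)"
    by (auto intro!: derivative_eq_intros)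
  have "(?f \<circ> (\<lambda>t. m * t + k) has_vector_derivative m *\<^sub>R vector_derivative ?f (at (m * t + k))) (at t)"
    by (rule vector_diff_chain_at[OF g f])
  then have "velocity M (\<lambda>t. \<gamma> (m * t + k)) t = m *\<^sub>R velocity M \<gamma> (m * t + k)"
    using vector_derivative_at by (fastforce simp: velocity_def o_def)
  then show ?thesis by (simp add: speed_def tnorm_scaleR assms(2))
qed

lemma speed_cong:
  assumes "\<forall>\<^sub>F s in nhds t. \<gamma> s = \<eta> s"
  shows "speed M \<gamma> t = speed M \<eta> t"
proof -
  have t: "\<gamma> t = \<eta> t" using assms eventually_nhds_x_imp_x by fast
  have "velocity M \<gamma> t = velocity M \<eta> t"
    unfolding velocity_def t
    by (rule vector_derivative_cong_eq) (use assms in \<open>auto elim: eventually_mono\<close>)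
  then show ?thesis by (simp add: speed_def t)
qed

lemma curve_points: "curve_of_length M p q \<gamma> l \<Longrightarrow> t \<in> {0..1} \<Longrightarrow> \<gamma> t \<in> points M"
  using path_image_subset_topspace[of "topol M" \<gamma>]
  by (auto simp: curve_of_length_def piecewise_C1_curve_def points_def Pi_iff)

lemma curve_length_nonneg: 
  assumes "curve_of_length M p q \<gamma> l" shows "0 \<le> l"
proof -
  have "(speed M \<gamma> has_integral l) {0..1}" using assms by (simp add: curve_of_length_def)
  then show ?thesis
    by (rule has_integral_nonneg) (use assms in \<open>auto simp: speed_def intro!: tnorm_nonneg curve_points\<close>)
qed

lemma const_curve: "p \<in> points M \<Longrightarrow> curve_of_length M p p (\<lambda>_. p) 0"
proof -
  assume p: "p \<in> points M"
  have "speed M (\<lambda>_. p) t = 0" for t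
    using tnorm_scaleR[OF p, of 0 0] by (simp add: speed_def velocity_def o_def)
  then have "(speed M (\<lambda>_. p) has_integral 0) {0..1}"
    by (metis (mono_tags, lifting) has_integral_is_0)
  then show ?thesis using p
    by (auto simp: curve_of_length_def piecewise_C1_curve_def points_def o_def
        intro: piecewise_C1_differentiable_const)
qed

lemma curve_affine:
  assumes \<gamma>: "curve_of_length M p q \<gamma> l" and m: "m \<noteq> 0"
    and ab: "(\<lambda>t. m * t + k) ` {a..b} = {0..1}"
  shows "(speed M (\<lambda>t. \<gamma> (m * t + k)) has_integral l) {a..b}"
    and "continuous_map (top_of_set {a..b}) (topol M) (\<lambda>t. \<gamma> (m * t + k))"
    and "\<And>c x y. \<lbrakk>c \<in> atlas M; a \<le> x; x \<le> y; y \<le> b; (\<lambda>t. \<gamma> (m * t + k)) ` {x..y} \<subseteq> fst c\<rbrakk>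
      \<Longrightarrow> (snd c \<circ> (\<lambda>t. \<gamma> (m * t + k))) piecewise_C1_differentiable_on {x..y}"
proof -
  have pw: "piecewise_C1_curve M \<gamma>" and path: "pathin (topol M) \<gamma>"
    using \<gamma> by (auto simp: curve_of_length_def piecewise_C1_curve_def)
  obtain S where S: "finite S" "\<And>t. t \<in> {0..1} - S \<Longrightarrow> (snd (chart_at M (\<gamma> t)) \<circ> \<gamma>) differentiable (at t)"
    using curve_differentiable[OF pw] by blast
  have img: "m * t + k \<in> {0..1}" if "t \<in> {a..b}" for t using ab that by blast
  have "((\<lambda>t. speed M \<gamma> (m *\<^sub>R t + k)) has_integral (1 / \<bar>m\<bar>) *\<^sub>R l)
     ((\<lambda>x. (1 / m) *\<^sub>R x + - ((1 / m) *\<^sub>R k)) ` cbox 0 1)"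
    using has_integral_affinity[of "speed M \<gamma>" l 0 1 m k] \<gamma> m by (simp add: curve_of_length_def)
  also have "(\<lambda>x. (1 / m) *\<^sub>R x + - ((1 / m) *\<^sub>R k)) ` cbox 0 1 = {a..b}"
    unfolding cbox_interval ab[symmetric] image_image using m by (simp add: field_simps)
  finally have "((\<lambda>t. \<bar>m\<bar> * speed M \<gamma> (m *\<^sub>R t + k)) has_integral \<bar>m\<bar> * ((1 / \<bar>m\<bar>) *\<^sub>R l)) {a..b}"
    by (rule has_integral_mult_right)
  then have int: "((\<lambda>t. \<bar>m\<bar> * speed M \<gamma> (m * t + k)) has_integral l) {a..b}" using m by simp
  have fin: "finite ((\<lambda>t. m * t + k) -` S)"
    using S(1) m by (intro finite_vimageI) (auto simp: inj_on_def)
  show "(speed M (\<lambda>t. \<gamma> (m * t + k)) has_integral l) {a..b}"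
  proof (rule has_integral_spike_finite[OF fin _ int])
    fix t assume t: "t \<in> {a..b} - (\<lambda>t. m * t + k) -` S"
    then show "speed M (\<lambda>t. \<gamma> (m * t + k)) t = \<bar>m\<bar> * speed M \<gamma> (m * t + k)"
      using img[of t] by (intro speed_affine S(2) curve_points[OF \<gamma>]) auto
  qed
  have "continuous_map (top_of_set {a..b}) (top_of_set {0..1}) (\<lambda>t. m * t + k)"
    using img by (auto simp: continuous_map_in_subtopology intro!: continuous_intros)
  from continuous_map_compose[OF this] path
  show "continuous_map (top_of_set {a..b}) (topol M) (\<lambda>t. \<gamma> (m * t + k))"
    by (simp add: pathin_def o_def)
  fix c x y assume c: "c \<in> atlas M" and xy: "a \<le> x" "x \<le> y" "y \<le> b" and
    sub: "(\<lambda>t. \<gamma> (m * t + k)) ` {x..y} \<subseteq> fst c"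
  obtain u w where uw: "(\<lambda>t. m * t + k) ` {x..y} = {u..w}" "u \<le> w"
  proof (cases "0 \<le> m")
    case True
    then show ?thesis
      using that[of "m * x + k" "m * y + k"] image_affinity_atLeastAtMost[of m k x y] xy(2)
        mult_left_mono[of x y m] by simp
  next
    case False
    then show ?thesis
      using that[of "m * y + k" "m * x + k"] image_affinity_atLeastAtMost[of m k x y] xy(2)
        mult_left_mono_neg[of x y m] by simp
  qed
  have "{u..w} \<subseteq> {0..1}"
    unfolding uw(1)[symmetric] using xy by (intro image_subsetI img) auto
  moreover have "\<gamma> ` {u..w} \<subseteq> fst c" using sub unfolding uw(1)[symmetric] by auto
  ultimately have "(snd c \<circ> \<gamma>) piecewise_C1_differentiable_on {u..w}"
    using pw c uw(2) unfolding piecewise_C1_curve_def by auto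
  then have "((snd c \<circ> \<gamma>) \<circ> (\<lambda>t. m *\<^sub>R t + k)) piecewise_C1_differentiable_on {x..y}"
    by (intro piecewise_C1_differentiable_affine) (simp add: uw)
  then show "(snd c \<circ> (\<lambda>t. \<gamma> (m * t + k))) piecewise_C1_differentiable_on {x..y}"
    by (simp add: o_def)
qed

lemma reverse_curve:
  assumes "curve_of_length M p q \<gamma> l"
  shows "curve_of_length M q p (\<lambda>t. \<gamma> (-1 * t + 1)) l"
proof -
  have img: "(\<lambda>t::real. -1 * t + 1) ` {0..1} = {0..1}"
    by (subst image_affinity_atLeastAtMost) auto
  show ?thesis
    using curve_affine[OF assms _ img] assms
    by (auto simp: curve_of_length_def piecewise_C1_curve_def pathin_def)
qed

lemma join_curve:
  assumes 1: "curve_of_length M p q \<gamma> k" and 2: "curve_of_length M q r \<eta> l"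
  shows "curve_of_length M p r (\<lambda>t. if t \<le> 1/2 then \<gamma> (2 * t + 0) else \<eta> (2 * t + - 1)) (k + l)"
    (is "curve_of_length M p r ?\<zeta> _")
proof -
  have img: "(\<lambda>t::real. 2 * t + 0) ` {0..1/2} = {0..1}" "(\<lambda>t::real. 2 * t + - 1) ` {1/2..1} = {0..1}"
    by (subst image_affinity_atLeastAtMost; simp)+
  note A = curve_affine[OF 1 _ img(1), simplified] and B = curve_affine[OF 2 _ img(2), simplified]
  have e: "\<gamma> 1 = q" "\<eta> 0 = q" "\<gamma> 0 = p" "\<eta> 1 = r" using 1 2 by (auto simp: curve_of_length_def)
  have "(speed M ?\<zeta> has_integral k) {0..1/2}"
  proof (rule has_integral_spike_finite[of "{1/2}", OF _ _ A(1)])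
    fix t :: real assume "t \<in> {0..1/2} - {1/2}"
    then have "t \<in> {..<1/2}" by auto
    then have "\<forall>\<^sub>F s in nhds t. s < 1/2" using eventually_nhds_in_open[of "{..<1/2}" t] by simp
    then show "speed M ?\<zeta> t = speed M (\<lambda>t. \<gamma> (2 * t)) t"
      by (intro speed_cong) (auto elim: eventually_mono)
  qed auto
  moreover have "(speed M ?\<zeta> has_integral l) {1/2..1}"
  proof (rule has_integral_spike_finite[of "{1/2}", OF _ _ B(1)])
    fix t :: real assume "t \<in> {1/2..1} - {1/2}"
    then have "t \<in> {1/2<..}" by auto
    then have "\<forall>\<^sub>F s in nhds t. s > 1/2" using eventually_nhds_in_open[of "{1/2<..}" t] by simp
    then show "speed M ?\<zeta> t = speed M (\<lambda>t. \<eta> (2 * t - 1)) t"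
      by (intro speed_cong) (auto elim: eventually_mono)
  qed auto
  ultimately have int: "(speed M ?\<zeta> has_integral (k + l)) {0..1}"
    by (rule has_integral_combine[rotated 2]) auto
  have "continuous_map (top_of_set {0..1}) (topol M) ?\<zeta>"
  proof (rule continuous_map_cases_le)
    show "continuous_map (subtopology (top_of_set {0..1}) {x \<in> topspace (top_of_set {0..1}). x \<le> 1/2}) (topol M) (\<lambda>t. \<gamma> (2 * t + 0))"
      using A(2) by (auto simp: subtopology_subtopology elim!: continuous_map_from_subtopology_mono)
    show "continuous_map (subtopology (top_of_set {0..1}) {x \<in> topspace (top_of_set {0..1}). 1/2 \<le> x}) (topol M) (\<lambda>t. \<eta> (2 * t + -1))"
      using B(2) by (auto simp: subtopology_subtopology elim!: continuous_map_from_subtopology_mono)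
    fix t :: real assume "t \<in> topspace (top_of_set {0..1})" "t = 1/2"
    then have "2 * t + 0 = 1" "2 * t + -1 = 0" by simp_all
    then show "\<gamma> (2 * t + 0) = \<eta> (2 * t + - 1)" by (simp only: e)
  qed auto
  moreover have "(snd c \<circ> ?\<zeta>) piecewise_C1_differentiable_on {a..b}"
    if c: "c \<in> atlas M" and ab: "0 \<le> a" "a \<le> b" "b \<le> 1" and sub: "?\<zeta> ` {a..b} \<subseteq> fst c" for c a b
  proof -
    have lo: "?\<zeta> t = \<gamma> (2 * t)" if "t \<le> 1/2" for t using that by simp
    have hi: "?\<zeta> t = \<eta> (2 * t - 1)" if "t \<ge> 1/2" for t
    proof (cases "t = 1/2")
      case True
      then have "2 * t + 0 = 1" "2 * t - 1 = 0" "t \<le> 1/2" by simp_all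
      then show ?thesis by (simp only: e if_True)
    qed (use that in auto)
    have in_c: "?\<zeta> t \<in> fst c" if "a \<le> t" "t \<le> b" for t
      using that by (intro subsetD[OF sub] imageI) auto
    have f: "(snd c \<circ> (\<lambda>t. \<gamma> (2 * t))) piecewise_C1_differentiable_on {a..y}"
      if "a \<le> y" "y \<le> b" "y \<le> 1/2" for y
    proof (rule A(3)[OF c])
      show "(\<lambda>t. \<gamma> (2 * t)) ` {a..y} \<subseteq> fst c"
      proof (rule image_subsetI)
        fix t assume "t \<in> {a..y}"
        then show "\<gamma> (2 * t) \<in> fst c" using in_c[of t] lo[of t] that by simp
      qed
    qed (use that ab in auto)
    have g: "(snd c \<circ> (\<lambda>t. \<eta> (2 * t - 1))) piecewise_C1_differentiable_on {x..b}"
      if "a \<le> x" "x \<le> b" "1/2 \<le> x" for x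
    proof (rule B(3)[OF c])
      show "(\<lambda>t. \<eta> (2 * t - 1)) ` {x..b} \<subseteq> fst c"
      proof (rule image_subsetI)
        fix t assume "t \<in> {x..b}"
        then have "a \<le> t" "t \<le> b" "1/2 \<le> t" using that by auto
        then show "\<eta> (2 * t - 1) \<in> fst c" using in_c[of t] hi[of t] by metis
      qed
    qed (use that ab in auto)
    consider "b \<le> 1/2" | "a \<ge> 1/2" | "a < 1/2" "1/2 < b" by linarith
    then show ?thesis
    proof cases
      case 1
      show ?thesis
        by (rule piecewise_C1_differentiable_cong[OF f[of b]]) (use 1 ab in auto)
    next
      case 2
      show ?thesis
      proof (rule piecewise_C1_differentiable_cong[OF g[of a]])
        fix t assume "t \<in> {a..b}"
        then have "1/2 \<le> t" using 2 by auto
        then show "(snd c \<circ> (\<lambda>t. \<eta> (2 * t - 1))) t = (snd c \<circ> ?\<zeta>) t"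
          unfolding o_def by (simp only: hi)
      qed (use 2 ab in auto)
    next
      case 3
      have "(\<lambda>t. if t \<le> 1/2 then (snd c \<circ> (\<lambda>t. \<gamma> (2 * t))) t else (snd c \<circ> (\<lambda>t. \<eta> (2 * t - 1))) t)
        piecewise_C1_differentiable_on {a..b}"
        by (rule piecewise_C1_differentiable_cases[OF f g]) (use 3 e in auto)
      then show ?thesis by (rule piecewise_C1_differentiable_cong) auto
    qed
  qed
  ultimately show ?thesis
    using int e unfolding curve_of_length_def piecewise_C1_curve_def pathin_def by auto
qed

lemma metric_along_line:
  assumes c: "c \<in> atlas M" and line: "\<And>t. t \<in> T \<Longrightarrow> x t \<in> snd c ` fst c" and x: "continuous_on T x"
  shows "continuous_on T (\<lambda>t. metric M c (param c (x t)) v w)"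
  using continuous_on_compose2[OF smooth_onD(1)[OF metric_smooth[OF c]] x] line by auto

lemma segment_curve:
  assumes c: "c \<in> atlas M" and sub: "closed_segment x y \<subseteq> snd c ` fst c"
  shows "\<exists>\<gamma> l. curve_of_length M (param c x) (param c y) \<gamma> l"
proof -
  let ?x = "linepath x y"
  define \<gamma> where "\<gamma> = param c \<circ> ?x"
  have in_V: "?x t \<in> snd c ` fst c" if "t \<in> {0..1}" for t
    using that sub by (metis linepath_image_01 imageI subsetD)
  have "continuous_map (top_of_set {0..1}) (top_of_set (snd c ` fst c)) ?x"
    using in_V by (auto simp: continuous_map_in_subtopology intro!: continuous_intros)
  then have path: "pathin (topol M) \<gamma>"
    unfolding pathin_def \<gamma>_def using chartD(5)[OF c] continuous_map_compose by blast
  have in_c: "\<gamma> t \<in> fst c" if "t \<in> {0..1}" for t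
    using in_V[OF that] chartD(8)[OF c] by (simp add: \<gamma>_def)
  have coord: "snd c (\<gamma> t) = ?x t" if "t \<in> {0..1}" for t
    using in_V[OF that] chartD(7)[OF c] by (simp add: \<gamma>_def)
  have vel: "((snd c \<circ> \<gamma>) has_vector_derivative (y - x)) (at t)" if "t \<in> {0<..<1}" for t
    by (rule has_vector_derivative_transform_within_open[of ?x _ _ "{0<..<1}"])
      (use that coord has_vector_derivative_linepath_within in auto)
  have "(snd d \<circ> \<gamma>) piecewise_C1_differentiable_on {a..b}"
    if d: "d \<in> atlas M" and ab: "0 \<le> a" "a \<le> b" "b \<le> 1" and sub: "\<gamma> ` {a..b} \<subseteq> fst d" for d a b
    unfolding piecewise_C1_differentiable_on_def
  proof (intro conjI exI)
    have "continuous_map (top_of_set {a..b}) (subtopology (topol M) (fst d)) \<gamma>"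
      using path sub ab unfolding pathin_def continuous_map_in_subtopology
      by (auto elim!: continuous_map_from_subtopology_mono)
    from continuous_map_compose[OF this chartD(4)[OF d]]
    show "continuous_on {a..b} (snd d \<circ> \<gamma>)"
      by (simp add: continuous_map_in_subtopology)
    show "finite {a, b}" by simp
    let ?D = "\<lambda>t. frechet_derivative (transition c d) (at (?x t)) (y - x)"
    have in_cd: "\<gamma> t \<in> fst c \<inter> fst d" if "t \<in> {a..b} - {a, b}" for t
      using that in_c[of t] sub ab by auto
    show "(snd d \<circ> \<gamma>) C1_differentiable_on {a..b} - {a, b}"
      unfolding C1_differentiable_on_def
    proof (intro exI[of _ ?D] conjI ballI)
      fix t assume t: "t \<in> {a..b} - {a, b}"
      then have t01: "t \<in> {0<..<1}" using ab by auto
      have "((snd d \<circ> \<gamma>) has_vector_derivative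
          frechet_derivative (transition c d) (at (snd c (\<gamma> t))) (y - x)) (at t)"
        by (rule change_chart[OF c d _ _ vel[OF t01]];
            rule pathin_eventually[OF path _ t01]; use chartD(1) c d in_cd[OF t] in blast)
      then show "((snd d \<circ> \<gamma>) has_vector_derivative ?D t) (at t)"
        using t01 by (simp add: coord)
    next
      have "?x t \<in> snd c ` (fst c \<inter> fst d)" if t: "t \<in> {a..b} - {a, b}" for t
        using in_cd[OF t] coord[of t] t ab by (metis DiffD1 atLeastAtMost_iff imageI order_trans)
      then show "continuous_on ({a..b} - {a, b}) ?D"
        by (intro continuous_on_compose2[OF smooth_onD(3)[OF smooth_transition[OF c d]]] continuous_intros image_subsetI)
    qed
  qed
  then have pw: "piecewise_C1_curve M \<gamma>" using path by (auto simp: piecewise_C1_curve_def)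
  let ?s = "\<lambda>t. sqrt (metric M c (param c (?x t)) (y - x) (y - x))"
  have "continuous_on {0..1} ?s"
    by (intro continuous_intros metric_along_line[OF c] in_V) auto
  then have "?s integrable_on {0..1}" using integrable_continuous_real by blast
  then obtain l where l: "(?s has_integral l) {0..1}" by blast
  have "(speed M \<gamma> has_integral l) {0..1}"
  proof (rule has_integral_spike_finite[OF _ _ l])
    show "finite {0, 1 :: real}" by simp
    fix t :: real assume "t \<in> {0..1} - {0, 1}"
    then have t: "t \<in> {0<..<1}" by auto
    show "speed M \<gamma> t = ?s t"
      using speed_chart(1)[OF c path t _ vel[OF t]] in_c[of t] t by (simp add: \<gamma>_def)
  qed
  then have "curve_of_length M (param c x) (param c y) \<gamma> l"
    using pw by (simp add: curve_of_length_def \<gamma>_def linepath_0' linepath_1')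
  then show ?thesis by blast
qed

definition joined :: "'a \<Rightarrow> 'a \<Rightarrow> bool" where
  "joined p q \<longleftrightarrow> (\<exists>\<gamma> l. curve_of_length M p q \<gamma> l)"

lemma joined_sym: "joined p q \<Longrightarrow> joined q p"
  unfolding joined_def using reverse_curve by blast

lemma joined_trans: "joined p q \<Longrightarrow> joined q r \<Longrightarrow> joined p r"
  unfolding joined_def using join_curve by blast

lemma joined_local:
  assumes "p \<in> points M"
  obtains W where "openin (topol M) W" "p \<in> W" "\<And>q. q \<in> W \<Longrightarrow> joined p q"
proof -
  let ?c = "chart_at M p"
  have c: "?c \<in> atlas M" "p \<in> fst ?c" using chart_at[OF assms] by auto
  obtain e where e: "e > 0" "ball (snd ?c p) e \<subseteq> snd ?c ` fst ?c"
    using chartD(2)[OF c(1)] c(2) open_contains_ball by blast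
  define W where "W = {q \<in> fst ?c. snd ?c q \<in> ball (snd ?c p) e}"
  have fst_top: "topspace (subtopology (topol M) (fst ?c)) = fst ?c"
    using chartD(9)[OF c(1)] by (auto simp: points_def)
  have "openin (top_of_set (snd ?c ` fst ?c)) (ball (snd ?c p) e)"
    using e(2) by (intro open_subset) auto
  then have "openin (subtopology (topol M) (fst ?c)) {q \<in> fst ?c. snd ?c q \<in> ball (snd ?c p) e}"
    using openin_continuous_map_preimage[OF chartD(4)[OF c(1)], unfolded fst_top] by blast
  then have "openin (topol M) W"
    using chartD(1)[OF c(1)] openin_trans_full W_def by blast
  moreover have "p \<in> W" using c e by (simp add: W_def)
  moreover have "joined p q" if "q \<in> W" for q
  proof -
    have "closed_segment (snd ?c p) (snd ?c q) \<subseteq> ball (snd ?c p) e"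
      using that e(1) by (intro closed_segment_subset) (auto simp: W_def)
    then have "closed_segment (snd ?c p) (snd ?c q) \<subseteq> snd ?c ` fst ?c" using e(2) by blast
    from segment_curve[OF c(1) this] show ?thesis
      using that c chartD(6)[OF c(1)] by (auto simp: joined_def W_def)
  qed
  ultimately show ?thesis using that by blast
qed

lemma all_joined:
  assumes "p \<in> points M" "q \<in> points M" shows "joined p q"
proof -
  define T where "T = {r \<in> points M. joined p r}"
  have open1: "openin (topol M) T"
  proof (subst openin_subopen, intro ballI)
    fix r assume r: "r \<in> T"
    then obtain W where W: "openin (topol M) W" "r \<in> W" "\<And>s. s \<in> W \<Longrightarrow> joined r s"
      using joined_local[of r] by (auto simp: T_def)
    then have "W \<subseteq> T"
      using r joined_trans openin_subset[OF W(1)] by (auto simp: T_def points_def)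
    then show "\<exists>W. openin (topol M) W \<and> r \<in> W \<and> W \<subseteq> T" using W by blast
  qed
  have "openin (topol M) (points M - T)"
  proof (subst openin_subopen, intro ballI)
    fix r assume r: "r \<in> points M - T"
    then obtain W where W: "openin (topol M) W" "r \<in> W" "\<And>s. s \<in> W \<Longrightarrow> joined r s"
      using joined_local[of r] by auto
    then have "W \<subseteq> points M - T"
      using r joined_trans joined_sym openin_subset[OF W(1)] unfolding T_def points_def by blast
    then show "\<exists>W. openin (topol M) W \<and> r \<in> W \<and> W \<subseteq> points M - T" using W by blast
  qed
  then have "closedin (topol M) T" by (auto simp: closedin_def T_def points_def)
  then have "T = {} \<or> T = points M"
    using connected open1 unfolding connected_space_clopen_in points_def by blast
  moreover have "p \<in> T" using const_curve assms by (auto simp: T_def joined_def)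
  ultimately show ?thesis using assms by (auto simp: T_def)
qed

lemma rdist_le: "curve_of_length M p q \<gamma> l \<Longrightarrow> rdist M p q \<le> l"
  using curve_points[of p q \<gamma> l 0] curve_points[of p q \<gamma> l 1] curve_length_nonneg
  by (auto simp: rdist_def curve_of_length_def intro!: cInf_lower bdd_belowI[of _ 0])

lemma rdist_ge:
  assumes "p \<in> points M" "q \<in> points M" "\<And>\<gamma> l. curve_of_length M p q \<gamma> l \<Longrightarrow> b \<le> l"
  shows "b \<le> rdist M p q"
  using all_joined[OF assms(1,2)] assms
  by (auto simp: rdist_def joined_def intro!: cInf_greatest)

lemma metric_lower_bound:
  assumes c: "c \<in> atlas M" and K: "compact K" "K \<subseteq> snd c ` fst c"
  obtains m where "m > 0" "\<And>x v. x \<in> K \<Longrightarrow> m * norm v \<le> sqrt (metric M c (param c x) v v)"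
proof (cases "K = {}")
  case True
  then show ?thesis using that[of 1] by auto
next
  case False
  let ?h = "\<lambda>z. metric M c (param c (fst z)) (snd z) (snd z)"
  let ?S = "sphere (0::'e) 1"
  have inner: "inner_product (metric M c (param c x))" if "x \<in> K" for x
    using metric_inner[OF c] chartD(8)[OF c] K that by blast
  have expand: "?h z = (\<Sum>i\<in>Basis. \<Sum>j\<in>Basis. (snd z \<bullet> i) * (snd z \<bullet> j) * metric M c (param c (fst z)) i j)"
    if "z \<in> K \<times> ?S" for z
  proof -
    let ?g = "metric M c (param c (fst z))"
    have lin: "linear (?g v)" and sym: "?g v w = ?g w v" for v w
      using inner[of "fst z"] that by (auto simp: inner_product_def mem_Times_iff)
    have "?g v w = (\<Sum>j\<in>Basis. (w \<bullet> j) * ?g v j)" for v w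
      using linear_sum[OF lin, of v "\<lambda>j. (w \<bullet> j) *\<^sub>R j" Basis] linear_cmul[OF lin]
      by (simp add: euclidean_representation)
    note E = this
    have "?h z = (\<Sum>j\<in>Basis. (snd z \<bullet> j) * ?g j (snd z))"
      by (subst E) (simp only: sym)
    also have "\<dots> = (\<Sum>j\<in>Basis. \<Sum>i\<in>Basis. (snd z \<bullet> j) * (snd z \<bullet> i) * ?g j i)"
      by (subst E) (simp only: sum_distrib_left mult.assoc)
    finally show ?thesis .
  qed
  have "continuous_on (K \<times> ?S) (\<lambda>z. \<Sum>i\<in>Basis. \<Sum>j\<in>Basis. (snd z \<bullet> i) * (snd z \<bullet> j) * metric M c (param c (fst z)) i j)"
    by (intro continuous_intros metric_along_line[OF c]) (use K in auto)
  then have cont: "continuous_on (K \<times> ?S) ?h"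
    by (rule continuous_on_eq) (use expand in auto)
  have "compact (K \<times> ?S)" "K \<times> ?S \<noteq> {}"
    using K False by (auto intro: compact_Times)
  then obtain z where z: "z \<in> K \<times> ?S" "\<And>y. y \<in> K \<times> ?S \<Longrightarrow> ?h z \<le> ?h y"
    using continuous_attains_inf[OF _ _ cont] by blast
  have "fst z \<in> K" "snd z \<noteq> 0" using z(1) by (auto simp: mem_Times_iff)
  then have "?h z > 0" using inner unfolding inner_product_def by blast
  moreover have "sqrt (?h z) * norm v \<le> sqrt (metric M c (param c x) v v)" if x: "x \<in> K" for x v
  proof (cases "v = 0")
    case False
    have "?h z \<le> ?h (x, v /\<^sub>R norm v)" using z(2)[of "(x, v /\<^sub>R norm v)"] x False by auto
    also have "\<dots> = (inverse (norm v))\<^sup>2 * metric M c (param c x) v v"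
      using inner_product_scaleR[OF inner[OF x]] by simp
    finally have "?h z * (norm v)\<^sup>2 \<le> metric M c (param c x) v v"
      using False by (simp add: field_simps)
    then have "sqrt (?h z * (norm v)\<^sup>2) \<le> sqrt (metric M c (param c x) v v)" by simp
    then show ?thesis by (simp add: real_sqrt_mult)
  qed (use inner_product_posdef[OF inner[OF x], of 0] in auto)
  ultimately show ?thesis using that[of "sqrt (?h z)"] by simp
qed

lemma rdist_pos:
  assumes p: "p \<in> points M" and q: "q \<in> points M" and "p \<noteq> q"
  shows "0 < rdist M p q"
proof -
  let ?c = "chart_at M p"
  have c: "?c \<in> atlas M" "p \<in> fst ?c" using chart_at[OF p] by auto
  let ?x = "snd ?c p"
  have "\<exists>e>0. cball ?x e \<subseteq> snd ?c ` fst ?c - {snd ?c q | u::unit. q \<in> fst ?c}"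
  proof -
    have "open (snd ?c ` fst ?c - {snd ?c q | u::unit. q \<in> fst ?c})"
      using chartD(2)[OF c(1)] by (cases "q \<in> fst ?c") (auto intro: open_delete)
    moreover have "?x \<in> snd ?c ` fst ?c - {snd ?c q | u::unit. q \<in> fst ?c}"
      using c(2) assms(3) chartD(3)[OF c(1)] by (auto dest: inj_onD)
    ultimately show ?thesis unfolding open_contains_cball by blast
  qed
  then obtain e where e: "e > 0" "cball ?x e \<subseteq> snd ?c ` fst ?c" "q \<in> fst ?c \<Longrightarrow> snd ?c q \<notin> cball ?x e"
    by blast
  obtain m where m: "m > 0" "\<And>x v. x \<in> cball ?x e \<Longrightarrow> m * norm v \<le> sqrt (metric M ?c (param ?c x) v v)"
    using metric_lower_bound[OF c(1) compact_cball e(2)] by blast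
  have "m * e \<le> l" if \<gamma>: "curve_of_length M p q \<gamma> l" for \<gamma> l
  proof -
    have pw: "piecewise_C1_curve M \<gamma>" and path: "pathin (topol M) \<gamma>" and ends: "\<gamma> 0 = p" "\<gamma> 1 = q"
      and int: "(speed M \<gamma> has_integral l) {0..1}"
      using \<gamma> by (auto simp: curve_of_length_def piecewise_C1_curve_def)
    define W where "W = {r \<in> fst ?c. snd ?c r \<in> ball ?x e}"
    have fst_top: "topspace (subtopology (topol M) (fst ?c)) = fst ?c"
      using chartD(9)[OF c(1)] by (auto simp: points_def)
    have "openin (top_of_set (snd ?c ` fst ?c)) (ball ?x e)"
      using e(2) ball_subset_cball[of ?x e] by (intro open_subset) auto
    then have "openin (subtopology (topol M) (fst ?c)) {q \<in> fst ?c. snd ?c q \<in> ball ?x e}"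
      using openin_continuous_map_preimage[OF chartD(4)[OF c(1)], unfolded fst_top] by blast
    then have W: "openin (topol M) W"
      using chartD(1)[OF c(1)] openin_trans_full W_def by blast
    have "compactin (top_of_set (snd ?c ` fst ?c)) (cball ?x e)"
      using e(2) by (simp add: compactin_subtopology)
    then have "compactin (topol M) (param ?c ` cball ?x e)"
      using chartD(5)[OF c(1)] image_compactin by blast
    then have K: "closedin (topol M) (param ?c ` cball ?x e)"
      using Hausdorff compactin_imp_closedin by blast
    have Ksub: "param ?c ` cball ?x e \<subseteq> fst ?c" using e(2) chartD(8)[OF c(1)] by blast
    have WK: "r \<in> param ?c ` cball ?x e" if "r \<in> W" for r
    proof (rule image_eqI)
      show "r = param ?c (snd ?c r)" using that chartD(6)[OF c(1)] by (simp add: W_def)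
      show "snd ?c r \<in> cball ?x e" using that by (simp add: W_def)
    qed
    have Kx: "snd ?c r \<in> cball ?x e" if "r \<in> param ?c ` cball ?x e" for r
      using that e(2) chartD(7)[OF c(1)] by (auto simp: subset_iff)
    define T where "T = {t \<in> {0..1}. \<gamma> t \<notin> W}"
    have "openin (top_of_set {0..1}) {t \<in> {0..1}. \<gamma> t \<in> W}"
      using path W openin_continuous_map_preimage[of "top_of_set {0..1::real}" "topol M" \<gamma> W]
      by (simp add: pathin_def)
    then have "closedin (top_of_set {0..1}) ({0..1} - {t \<in> {0..1}. \<gamma> t \<in> W})"
      by (metis closedin_diff closedin_topspace topspace_euclidean_subtopology)
    also have "{0..1} - {t \<in> {0..1}. \<gamma> t \<in> W} = T" by (auto simp: T_def)
    finally have "closed T" using closedin_closed_trans by blast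
    have "1 \<in> T" using ends e(3) by (auto simp: T_def W_def)
    define b where "b = Inf T"
    have bdd: "bdd_below T" by (auto simp: T_def intro: bdd_belowI[of _ 0])
    have "b \<in> T" unfolding b_def using closed_contains_Inf[OF _ bdd \<open>closed T\<close>] \<open>1 \<in> T\<close> by blast
    then have b: "b \<in> {0..1}" "\<gamma> b \<notin> W" by (auto simp: T_def)
    have before: "\<gamma> t \<in> W" if "0 \<le> t" "t < b" for t
    proof (rule ccontr)
      assume "\<gamma> t \<notin> W"
      then have "t \<in> T" using that b by (auto simp: T_def)
      then show False using cInf_lower[OF _ bdd] that by (force simp: b_def)
    qed
    have "0 < b"
      using b ends c(2) e(1) by (cases "b = 0") (auto simp: W_def)
    have "closedin (top_of_set {0..1}) {t \<in> {0..1}. \<gamma> t \<in> param ?c ` cball ?x e}"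
      using path K closedin_continuous_map_preimage[of "top_of_set {0..1::real}" "topol M" \<gamma> "param ?c ` cball ?x e"]
      by (simp add: pathin_def)
    then have "closed {t \<in> {0..1}. \<gamma> t \<in> param ?c ` cball ?x e}"
      using closedin_closed_trans by blast
    moreover have "{0<..<b} \<subseteq> {t \<in> {0..1}. \<gamma> t \<in> param ?c ` cball ?x e}"
      using before WK b by auto
    ultimately have "closure {0<..<b} \<subseteq> {t \<in> {0..1}. \<gamma> t \<in> param ?c ` cball ?x e}"
      using closure_minimal by blast
    then have inK: "\<gamma> t \<in> param ?c ` cball ?x e" if "t \<in> {0..b}" for t
      using that \<open>0 < b\<close> closure_greaterThanLessThan[of 0 b] by blast
    let ?f = "snd ?c \<circ> \<gamma>"
    have "\<gamma> ` {0..b} \<subseteq> fst ?c" using inK Ksub by blast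
    then have "?f piecewise_C1_differentiable_on {0..b}"
      using pw c b unfolding piecewise_C1_curve_def by auto
    then obtain S D where S: "continuous_on {0..b} ?f" "finite S"
      "\<And>t. t \<in> {0..b} - S \<Longrightarrow> (?f has_vector_derivative D t) (at t)"
      unfolding piecewise_C1_differentiable_on_def C1_differentiable_on_def by blast
    have intf: "(D has_integral (?f b - ?f 0)) {0..b}"
      by (rule fundamental_theorem_of_calculus_interior_strong[OF S(2) _ _ S(1)])
        (use \<open>0 < b\<close> S(3) in auto)
    let ?D = "\<lambda>t. if t \<in> S \<union> {0, b} then 0 else D t"
    have intD: "(?D has_integral (?f b - ?f 0)) {0..b}"
      by (rule has_integral_spike_finite[OF _ _ intf, of "S \<union> {0, b}"]) (use S(2) in auto)
    have sp: "speed M \<gamma> integrable_on {0..1}" using int by blast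
    have sp0: "speed M \<gamma> t \<ge> 0" if "t \<in> {0..1}" for t
      using that curve_points[OF \<gamma>] by (simp add: speed_def tnorm_nonneg)
    have spb: "speed M \<gamma> integrable_on {0..b}"
      using integrable_on_subinterval[OF sp] b by auto
    have bound: "norm (?D t) \<le> speed M \<gamma> t / m" if t: "t \<in> {0..b}" for t
    proof (cases "t \<in> S \<union> {0, b}")
      case True
      then show ?thesis using sp0[of t] t b m by auto
    next
      case False
      then have t01: "t \<in> {0<..<1}" using t b by auto
      have "\<gamma> t \<in> fst ?c" using inK t Ksub by blast
      then have "speed M \<gamma> t = sqrt (metric M ?c (\<gamma> t) (D t) (D t))"
        using S(3)[of t] t False by (intro speed_chart(1)[OF c(1) path t01]) auto
      moreover have "m * norm (D t) \<le> sqrt (metric M ?c (param ?c (snd ?c (\<gamma> t))) (D t) (D t))"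
        using m(2) Kx inK t by blast
      ultimately show ?thesis
        using False m(1) \<open>\<gamma> t \<in> fst ?c\<close> by (simp add: chartD(6)[OF c(1)] field_simps)
    qed
    have "norm (integral {0..b} ?D) \<le> integral {0..b} (\<lambda>t. speed M \<gamma> t / m)"
      by (rule Henstock_Kurzweil_Integration.integral_norm_bound_integral)
        (use intD spb bound in \<open>auto intro: integrable_on_divide\<close>)
    then have "norm (?f b - ?f 0) \<le> integral {0..b} (speed M \<gamma>) / m"
      using integral_unique[OF intD] by simp
    moreover have "e \<le> norm (?f b - ?f 0)"
    proof -
      have "\<gamma> b \<in> fst ?c" using inK[of b] Ksub \<open>0 < b\<close> by auto
      then have "snd ?c (\<gamma> b) \<notin> ball ?x e" using b by (auto simp: W_def)
      then show ?thesis using ends by (simp add: dist_norm norm_minus_commute)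
    qed
    moreover have "integral {0..b} (speed M \<gamma>) \<le> integral {0..1} (speed M \<gamma>)"
      by (rule integral_subset_le) (use b sp spb sp0 in auto)
    ultimately have "e \<le> l / m"
      using m(1) integral_unique[OF int] by (smt (verit) divide_right_mono)
    then show "m * e \<le> l" using m(1) by (simp add: field_simps)
  qed
  then have "m * e \<le> rdist M p q" using rdist_ge p q by blast
  then show ?thesis using m(1) e(1) by (smt (verit) mult_pos_pos)
qed

lemma rdist_nonneg: "0 \<le> rdist M p q"
  using rdist_ge[of p q 0] curve_length_nonneg by (cases "p \<in> points M \<and> q \<in> points M") (auto simp: rdist_def)

lemma rdist_commute: "rdist M p q = rdist M q p"
proof -
  have "{l. \<exists>\<gamma>. curve_of_length M p q \<gamma> l} = {l. \<exists>\<gamma>. curve_of_length M q p \<gamma> l}"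
    using reverse_curve by blast
  then show ?thesis by (simp add: rdist_def conj_commute)
qed

lemma rdist_triangle:
  assumes "p \<in> points M" "q \<in> points M" "r \<in> points M"
  shows "rdist M p r \<le> rdist M p q + rdist M q r"
proof -
  have "rdist M p r - l \<le> rdist M p q" if l: "curve_of_length M q r \<eta> l" for \<eta> l
  proof (rule rdist_ge[OF assms(1,2)])
    fix \<gamma> k assume "curve_of_length M p q \<gamma> k"
    then show "rdist M p r - l \<le> k" using rdist_le[OF join_curve[OF _ l]] by fastforce
  qed
  then have "rdist M p r - rdist M p q \<le> rdist M q r"
    by (intro rdist_ge[OF assms(2,3)]) (simp add: algebra_simps)
  then show ?thesis by simp
qed

sublocale Metric_space "points M" "rdist M"
proof
  fix p q r
  show "0 \<le> rdist M p q" "rdist M p q = rdist M q p" by (fact rdist_nonneg rdist_commute)+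
  show "rdist M p q = 0 \<longleftrightarrow> p = q" if "p \<in> points M" "q \<in> points M"
  proof
    show "p = q" if "rdist M p q = 0" using rdist_pos[of p q] that \<open>p \<in> points M\<close> \<open>q \<in> points M\<close> by force
    show "rdist M p q = 0" if "p = q"
      using rdist_le[OF const_curve[OF \<open>p \<in> points M\<close>]] rdist_nonneg[of p p] that by simp
  qed
  show "rdist M p r \<le> rdist M p q + rdist M q r" if "p \<in> points M" "q \<in> points M" "r \<in> points M"
    using rdist_triangle that .
qed

end

end

theory Submission
  imports Defs
begin

text \<open>Sort the balls into dyadic levels of decreasing radius, well-order each level, and
  select greedily: a ball is kept iff its center lies in no ball kept before it. The kept balls
  cover all centers, and if two kept balls of radii \<open>r \<le> s\<close> violate the separation condition of
  a Besicovitch family, then they lie in one level, so their centers have distance in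
  \<open>(r, s]\<close> with \<open>s \<le> 2r\<close>. Hence the larger kept balls in conflict with a given one of radius
  \<open>r\<close> have centers forming, with its own center, a strict \<open>r\<close>-net in \<open>B(x, 4r)\<close>, and there are
  at most \<open>C\<^sub>0\<close> of them. Among finitely many kept balls through one point, repeatedly keep
  one of least radius and discard those in conflict with it: the result is a Besicovitch family,
  with at most \<open>C\<^sub>1\<close> members, and each accounts for at most \<open>C\<^sub>0\<close> of the balls.\<close>

section \<open>Greedy selection in abstract families\<close>

text \<open>Well-founded recursion defines \<open>K\<close>: whether \<open>i\<close> is kept
  depends only on the kept elements below it. Read \<open>Q j i\<close> as: \<open>j\<close> blocks
  \<open>i\<close>.\<close>

lemma wf_greedy_selection:
  assumes "wf r"
  shows "\<exists>K\<subseteq>F. \<forall>i\<in>F. i \<in> K \<longleftrightarrow> (\<forall>j\<in>K. (j, i) \<in> r \<longrightarrow> \<not> Q j i)"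
proof (intro exI conjI ballI)
  define H where "H f i \<longleftrightarrow> i \<in> F \<and> (\<forall>j. (j, i) \<in> r \<longrightarrow> f j \<longrightarrow> \<not> Q j i)" for f i
  have K: "wfrec r H i \<longleftrightarrow> i \<in> F \<and> (\<forall>j. (j, i) \<in> r \<longrightarrow> wfrec r H j \<longrightarrow> \<not> Q j i)" for i
    by (subst wfrec[OF assms]) (auto simp: H_def cut_apply)
  show "{i. wfrec r H i} \<subseteq> F" using K by blast
  show "i \<in> {i. wfrec r H i} \<longleftrightarrow> (\<forall>j\<in>{i. wfrec r H i}. (j, i) \<in> r \<longrightarrow> \<not> Q j i)" if "i \<in> F" for i
    using K[of i] that by blast
qed

text \<open>By hypothesis, picking an element of least \<open>f\<close>-value and discarding its
  conflicts removes at most \<open>N\<close> elements, itself included. \<open>N\<close> may be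
  infinite, since it is to be \<open>C0\<close>, a supremum in \<open>ennreal\<close>.\<close>

lemma greedy_independent_set:
  fixes f :: "'b \<Rightarrow> 'c::linorder" and N :: ennreal
  assumes "finite I" "symp Q"
    and "\<And>i. i \<in> I \<Longrightarrow> of_nat (card {j \<in> I. f i \<le> f j \<and> (j = i \<or> Q i j)}) \<le> N"
  shows "\<exists>J\<subseteq>I. pairwise (\<lambda>i j. \<not> Q i j) J \<and> of_nat (card I) \<le> of_nat (card J) * N"
  using assms(1,3)
proof (induction I rule: finite_psubset_induct)
  case (psubset I)
  show ?case
  proof (cases "I = {}")
    case False
    then obtain i where i: "i \<in> I" "\<And>j. j \<in> I \<Longrightarrow> f i \<le> f j"
      using arg_min_if_finite[OF psubset.hyps(1)] by (metis not_le)
    \<comment> \<open>As \<open>f i\<close> is least, the condition \<open>f i \<le> f j\<close>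
      excludes nothing: \<open>?D\<close> consists of \<open>i\<close> and all its conflicts, so
      \<open>i\<close> can join any independent subset of \<open>I - ?D\<close>.\<close>
    let ?D = "{j \<in> I. f i \<le> f j \<and> (j = i \<or> Q i j)}"
    have D: "i \<in> ?D" "?D \<subseteq> I" using i by auto
    have bound: "of_nat (card {j \<in> I - ?D. f k \<le> f j \<and> (j = k \<or> Q k j)}) \<le> N" if "k \<in> I - ?D" for k
    proof -
      have "card {j \<in> I - ?D. f k \<le> f j \<and> (j = k \<or> Q k j)} \<le> card {j \<in> I. f k \<le> f j \<and> (j = k \<or> Q k j)}"
        by (rule card_mono) (use psubset.hyps in auto)
      then show ?thesis using psubset.prems[of k] that by (meson DiffD1 of_nat_mono order_trans)
    qed
    have "I - ?D \<subset> I" using D by blast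
    from psubset.IH[OF this bound] obtain J where J: "J \<subseteq> I - ?D" "pairwise (\<lambda>i j. \<not> Q i j) J"
      "of_nat (card (I - ?D)) \<le> of_nat (card J) * N"
      by blast
    have "finite J" "i \<notin> J" using J(1) D psubset.hyps finite_subset[of J I] by auto
    have "card I = card ?D + card (I - ?D)"
      using psubset.hyps D(2) by (metis (no_types, lifting) card_Diff_subset card_mono finite_subset le_add_diff_inverse)
    then have "(of_nat (card I) :: ennreal) = of_nat (card ?D) + of_nat (card (I - ?D))"
      by simp
    also have "\<dots> \<le> N + of_nat (card J) * N"
      using psubset.prems[OF i(1)] J(3) by (rule add_mono)
    also have "\<dots> = of_nat (card (insert i J)) * N"
      using \<open>finite J\<close> \<open>i \<notin> J\<close> by (simp add: algebra_simps)
    finally have "of_nat (card I) \<le> of_nat (card (insert i J)) * N" .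
    moreover have "pairwise (\<lambda>i j. \<not> Q i j) (insert i J)"
      using J(1,2) i(2) sympD[OF assms(2)] unfolding pairwise_insert by blast
    ultimately show ?thesis using i(1) J(1) by (intro exI[of _ "insert i J"]) blast
  qed (auto intro: exI[of _ "{}"])
qed

section \<open>Dyadic levels and the selection of balls\<close>

text \<open>The level of \<open>r\<close> is the \<open>n\<close> with
  \<open>D / 2 ^ (n + 1) < r \<le> D / 2 ^ n\<close>. A radius \<open>s\<close> at the same or a
  later level is at most \<open>D / 2 ^ n\<close>, hence below \<open>2 * r\<close>.\<close>

lemma dyadic_level_ratio:
  fixes r s D :: real
  assumes "0 < r" "r \<le> D" "0 < s" "s \<le> D" "nat \<lfloor>log 2 (D / r)\<rfloor> \<le> nat \<lfloor>log 2 (D / s)\<rfloor>"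
  shows "s \<le> 2 * r"
proof -
  \<comment> \<open>Radii are at most \<open>D\<close>, so \<open>nat\<close> truncates
    nothing.\<close>
  have "0 \<le> log 2 (D / r)" "0 \<le> log 2 (D / s)" using assms by auto
  then have "\<lfloor>log 2 (D / r)\<rfloor> \<le> \<lfloor>log 2 (D / s)\<rfloor>" using assms(5) by linarith
  then have "log 2 (D / r) \<le> log 2 (D / s) + 1" by linarith
  also have "log 2 (D / s) + 1 = log 2 (2 * (D / s))"
    using assms by (subst log_mult) auto
  finally have "D / r \<le> 2 * (D / s)" using assms by (subst (asm) log_le_cancel_iff) auto
  then show ?thesis using assms by (simp add: field_simps)
qed

context Metric_space
begin

text \<open>Of two kept balls, the earlier does not contain the center of the later. If the smaller
  came first, the levels give \<open>s \<le> 2 * r\<close>; if the larger came first,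
  \<open>s < d x y\<close> and the implication is vacuous.\<close>

lemma greedy_ball_selection:
  assumes F: "F \<subseteq> M \<times> {0<..D}"
  obtains K where "K \<subseteq> F" "\<And>x r. (x, r) \<in> F \<Longrightarrow> \<exists>(y, s)\<in>K. d y x \<le> s"
    "\<And>x r y s. \<lbrakk>(x, r) \<in> K; (y, s) \<in> K; (x, r) \<noteq> (y, s); r \<le> s\<rbrakk>
      \<Longrightarrow> r < d x y \<and> (d x y \<le> s \<longrightarrow> s \<le> 2 * r)"
proof -
  obtain W :: "('a \<times> real) rel" where W: "well_order_on UNIV W"
    using well_order_on by blast
  have total: "a = b \<or> (a, b) \<in> W - Id \<or> (b, a) \<in> W - Id" for a b
    using W unfolding well_order_on_def linear_order_on_def total_on_def by blast
  define l where "l b = nat \<lfloor>log 2 (D / snd b)\<rfloor>" for b :: "'a \<times> real"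
  \<comment> \<open>Decreasing radius alone need not be a well-founded order, as radii can increase
    forever. Levels are natural numbers, and \<open>W\<close> breaks ties.\<close>
  define R where "R = inv_image (less_than <*lex*> (W - Id)) (\<lambda>b. (l b, b))"
  have "wf R" unfolding R_def
    using W by (intro wf_inv_image wf_lex_prod wf_less_than) (simp add: well_order_on_def)
  have R_total: "a = b \<or> (a, b) \<in> R \<or> (b, a) \<in> R" for a b
    using total[of a b] by (cases "l a" "l b" rule: linorder_cases) (auto simp: R_def)
  obtain K where K: "K \<subseteq> F"
    "\<forall>i\<in>F. i \<in> K \<longleftrightarrow> (\<forall>j\<in>K. (j, i) \<in> R \<longrightarrow> \<not> d (fst j) (fst i) \<le> snd j)"
    using wf_greedy_selection[OF \<open>wf R\<close>, of F "\<lambda>j i. d (fst j) (fst i) \<le> snd j"]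
    by (elim exE conjE)
  have sep: "r < d x y \<and> s \<le> 2 * r" if "(x, r) \<in> K" "(y, s) \<in> K" "((x, r), (y, s)) \<in> R" for x r y s
  proof -
    have "(x, r) \<in> F" "(y, s) \<in> F" using that K(1) by auto
    moreover have "nat \<lfloor>log 2 (D / r)\<rfloor> \<le> nat \<lfloor>log 2 (D / s)\<rfloor>"
      using that(3) by (auto simp: R_def l_def)
    ultimately have "s \<le> 2 * r" using F by (intro dyadic_level_ratio[of r D s]) auto
    moreover have "r < d x y" using bspec[OF K(2) \<open>(y, s) \<in> F\<close>] that by force
    ultimately show ?thesis by blast
  qed
  show thesis
  proof (rule that[OF K(1)])
    fix x r assume x: "(x, r) \<in> F"
    then have "(x, r) \<in> K \<or> (\<exists>j\<in>K. d (fst j) x \<le> snd j)" using bspec[OF K(2) x] by auto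
    moreover have "d x x \<le> r" using x F by auto
    ultimately show "\<exists>(y, s)\<in>K. d y x \<le> s" by force
  next
    fix x r y s
    assume xy: "(x, r) \<in> K" "(y, s) \<in> K" "(x, r) \<noteq> (y, s)" "r \<le> s"
    consider "((x, r), (y, s)) \<in> R" | "((y, s), (x, r)) \<in> R"
      using R_total[of "(x, r)" "(y, s)"] xy(3) by blast
    then show "r < d x y \<and> (d x y \<le> s \<longrightarrow> s \<le> 2 * r)"
    proof cases
      case 1
      then show ?thesis using sep xy by blast
    next
      case 2
      then have "s < d y x" using sep xy by blast
      then show ?thesis using xy(4) by (simp add: commute)
    qed
  qed
qed

end

section \<open>Counting conflicts and balls through a point\<close>

lemma card_net_le_C0:
  assumes "finite P" "x \<in> A" "0 < r" "ennreal r < R_bound M A" "strict_net M r (rball M x (4 * r)) P"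
  shows "of_nat (card P) \<le> C0 M A"
proof -
  have "emeasure (count_space UNIV) P \<le> C0 M A"
    unfolding C0_def by (rule Sup_upper) (use assms in blast)
  then show ?thesis using assms(1) by (simp add: emeasure_count_space_finite)
qed

text \<open>One point is a strict net. The scale \<open>r / 2\<close> meets the strict bound in
  \<open>C0\<close>, since an admissible radius may equal \<open>R_bound M A\<close>.\<close>

lemma (in riemannian_manifold) C0_ge_1:
  assumes "(x, r) \<in> admissible_balls M A" "x \<in> points M"
  shows "1 \<le> C0 M A"
proof -
  have adm: "x \<in> A" "0 < r" "ennreal r \<le> R_bound M A" using assms(1) by (auto simp: admissible_balls_def)
  have "ennreal (r / 2) < ennreal r" using adm by (simp add: ennreal_less_iff)
  also note adm(3)
  finally have "ennreal (r / 2) < R_bound M A" .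
  then have "of_nat (card {x}) \<le> C0 M A"
    using adm assms(2) by (intro card_net_le_C0[of _ x _ "r / 2"]) (auto simp: strict_net_def)
  then show ?thesis by simp
qed

text \<open>A conflicting ball of radius \<open>s \<ge> r\<close> has its center at distance in
  \<open>(r, s]\<close> with \<open>s \<le> 2 * r\<close>, hence well inside
  \<open>rball M x (4 * r)\<close>. Centers in \<open>?D\<close> are further apart than the smaller
  of their radii, hence than \<open>r\<close>.\<close>

lemma (in riemannian_manifold) card_conflicts_le_C0:
  assumes "finite I" "I \<subseteq> admissible_balls M A" "A \<subseteq> points M" "(x, r) \<in> I"
    and sep: "\<And>x r y s. \<lbrakk>(x, r) \<in> I; (y, s) \<in> I; (x, r) \<noteq> (y, s); r \<le> s\<rbrakk>
      \<Longrightarrow> r < rdist M x y \<and> (rdist M x y \<le> s \<longrightarrow> s \<le> 2 * r)"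
  shows "of_nat (card {(y, s) \<in> I. r \<le> s \<and> ((y, s) = (x, r) \<or> rdist M x y \<le> max r s)}) \<le> C0 M A"
    (is "of_nat (card ?D) \<le> _")
\<comment> \<open>If \<open>(x, r)\<close> has no conflicts, \<open>r\<close> may equal
  \<open>R_bound M A\<close>, a scale outside the definition of \<open>C0\<close>; then
  \<open>C0_ge_1\<close> bounds the count.\<close>
proof (cases "?D \<subseteq> {(x, r)}")
  case True
  then have "card ?D \<le> 1" using card_mono[of "{(x, r)}" ?D] by simp
  then have "(of_nat (card ?D) :: ennreal) \<le> of_nat 1" by (rule of_nat_mono)
  also have "of_nat 1 \<le> C0 M A" using assms(2-4) by (simp, intro C0_ge_1[of x r]) (auto simp: admissible_balls_def)
  finally show ?thesis .
next
  case False
  have adm: "y \<in> A" "y \<in> points M" "0 < s" "ennreal s \<le> R_bound M A" if "(y, s) \<in> I" for y s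
    using that assms(2,3) by (auto simp: admissible_balls_def)
  have D: "(y, s) \<in> I" "r \<le> s" "rdist M x y \<le> 2 * r" "(y, s) \<noteq> (x, r) \<Longrightarrow> r < s" if "(y, s) \<in> ?D" for y s
    using that sep[OF assms(4), of y s] adm[OF assms(4)] by (cases "(y, s) = (x, r)"; force)+
  have pairs: "r < rdist M y z" if "(y, s) \<in> ?D" "(z, t) \<in> ?D" "(y, s) \<noteq> (z, t)" for y s z t
    using sep[of y s z t] sep[of z t y s] D[OF that(1)] D[OF that(2)] that(3) commute[of y z]
    by (cases "s \<le> t") auto
  \<comment> \<open>\<open>C0\<close> counts centers, \<open>?D\<close> counts balls. Distinct balls
    with a common center would have center distance 0, not above \<open>r\<close>.\<close>
  have "inj_on fst ?D"
  proof (rule inj_onI)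
    fix a b assume ab: "a \<in> ?D" "b \<in> ?D" "fst a = fst b"
    then obtain y s t where "a = (y, s)" "b = (y, t)" by (metis prod.collapse)
    then show "a = b" using pairs[of y s y t] ab D(1)[of y s] adm[of y s] adm(3)[OF assms(4)] by force
  qed
  \<comment> \<open>A second ball has \<open>r < s \<le> R_bound M A\<close>, which supplies the
    strict inequality in \<open>C0\<close>.\<close>
  obtain y s where "(y, s) \<in> ?D" "(y, s) \<noteq> (x, r)" using False by auto
  then have "r < s" "ennreal s \<le> R_bound M A" using D adm by blast+
  then have "ennreal r < R_bound M A"
    using adm(3)[OF assms(4)] by (meson ennreal_less_iff less_le_trans less_imp_le)
  moreover have "strict_net M r (rball M x (4 * r)) (fst ` ?D)"
    unfolding strict_net_def
  proof (intro conjI ballI impI)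
    show "fst ` ?D \<subseteq> rball M x (4 * r)"
    proof
      fix y assume "y \<in> fst ` ?D"
      then obtain s where "(y, s) \<in> ?D" by force
      then show "y \<in> rball M x (4 * r)"
        using D(1,3)[of y s] adm[of y s] adm[OF assms(4)] by auto
    qed
    fix p q assume "p \<in> fst ` ?D" "q \<in> fst ` ?D" "p \<noteq> q"
    then obtain s t where "(p, s) \<in> ?D" "(q, t) \<in> ?D" by force
    then show "r < rdist M p q" using pairs[of p s q t] \<open>p \<noteq> q\<close> by blast
  qed
  moreover have "finite ?D" using assms(1) by (rule rev_finite_subset) auto
  ultimately have "of_nat (card (fst ` ?D)) \<le> C0 M A"
    using adm[OF assms(4)] by (intro card_net_le_C0[of _ x _ r]) auto
  then show ?thesis using card_image[OF \<open>inj_on fst ?D\<close>] by simp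
qed

lemma (in riemannian_manifold) card_balls_at_point_le:
  assumes "finite I" "I \<subseteq> admissible_balls M A" "A \<subseteq> points M" "\<And>x r. (x, r) \<in> I \<Longrightarrow> p \<in> rball M x r"
    and C1: "\<And>B. \<lbrakk>besicovitch_family M B; B \<subseteq> admissible_balls M A\<rbrakk> \<Longrightarrow> real (card B) \<le> C1"
    and sep: "\<And>x r y s. \<lbrakk>(x, r) \<in> I; (y, s) \<in> I; (x, r) \<noteq> (y, s); r \<le> s\<rbrakk>
      \<Longrightarrow> r < rdist M x y \<and> (rdist M x y \<le> s \<longrightarrow> s \<le> 2 * r)"
  shows "of_nat (card I) \<le> ennreal C1 * C0 M A"
proof -
  \<comment> \<open>\<open>Q\<close> is the failure of Besicovitch separation: distance at most the
    larger radius means that some ball of the pair contains the center of the other.\<close>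
  define Q where "Q a b \<longleftrightarrow> rdist M (fst a) (fst b) \<le> max (snd a) (snd b)" for a b :: "'a \<times> real"
  have "symp Q" by (rule sympI) (auto simp: Q_def commute max.commute)
  have deg: "of_nat (card {j \<in> I. snd i \<le> snd j \<and> (j = i \<or> Q i j)}) \<le> C0 M A" if "i \<in> I" for i
  proof -
    obtain x r where i: "i = (x, r)" by force
    have "{j \<in> I. snd i \<le> snd j \<and> (j = i \<or> Q i j)}
        = {(y, s) \<in> I. r \<le> s \<and> ((y, s) = (x, r) \<or> rdist M x y \<le> max r s)}"
      by (auto simp: i Q_def)
    then show ?thesis
      using card_conflicts_le_C0[OF assms(1-3) _ sep, of x r] that i by simp
  qed
  obtain J where J: "J \<subseteq> I" "pairwise (\<lambda>i j. \<not> Q i j) J" "of_nat (card I) \<le> of_nat (card J) * C0 M A"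
    using greedy_independent_set[OF assms(1) \<open>symp Q\<close> deg] by blast
  have "besicovitch_family M J"
    unfolding besicovitch_family_def
  proof (intro conjI)
    show "finite J" using J(1) assms(1) finite_subset by blast
    have "p \<in> (\<Inter>(x, r)\<in>J. rball M x r)" using J(1) assms(4) by blast
    then show "(\<Inter>(x, r)\<in>J. rball M x r) \<noteq> {}" by blast
    have "y \<notin> rball M x r \<and> x \<notin> rball M y s" if "(x, r) \<in> J" "(y, s) \<in> J" "(x, r) \<noteq> (y, s)" for x r y s
      using pairwiseD[OF J(2) that] by (auto simp: Q_def commute)
    then show "\<forall>(x, r)\<in>J. \<forall>(y, s)\<in>J. (x, r) \<noteq> (y, s) \<longrightarrow> y \<notin> rball M x r \<and> x \<notin> rball M y s"
      by blast
  qed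
  then have "real (card J) \<le> C1" using C1 J(1) assms(2) by blast
  then have "of_nat (card J) \<le> ennreal C1"
    by (metis ennreal_leI ennreal_of_nat_eq_real_of_nat)
  then show ?thesis using J(3) mult_right_mono[of _ "ennreal C1" "C0 M A"] by (meson order_trans zero_le)
qed

section \<open>Sums of indicators and the conclusion\<close>

text \<open>In \<open>ennreal\<close> an infinite sum is the supremum of its finite partial sums, so
  counting finite subcollections suffices for \<open>K\<close> of any cardinality.\<close>

lemma infsum_indicator_le:
  fixes N :: ennreal
  assumes "\<And>I. \<lbrakk>finite I; I \<subseteq> K; \<And>i. i \<in> I \<Longrightarrow> y \<in> B i\<rbrakk> \<Longrightarrow> of_nat (card I) \<le> N"
  shows "(\<Sum>\<^sub>\<infinity>i\<in>K. indicator (B i) y) \<le> N"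
  unfolding nonneg_infsum_complete[OF zero_le]
proof (rule SUP_least)
  fix G assume G: "G \<in> {G. finite G \<and> G \<subseteq> K}"
  have "(\<Sum>i\<in>G. indicator (B i) y) = (of_nat (card {i \<in> G. y \<in> B i}) :: ennreal)"
    using G by (simp add: indicator_def sum.If_cases Int_def)
  also have "\<dots> \<le> N" using G by (intro assms) auto
  finally show "(\<Sum>i\<in>G. indicator (B i) y) \<le> N" .
qed

lemma infsum_indicator_ge_1:
  assumes "i \<in> K" "y \<in> B i"
  shows "1 \<le> (\<Sum>\<^sub>\<infinity>i\<in>K. indicator (B i) y :: ennreal)"
proof -
  have "(\<Sum>i\<in>{i}. indicator (B i) y :: ennreal) \<le> (SUP G\<in>{G. finite G \<and> G \<subseteq> K}. \<Sum>i\<in>G. indicator (B i) y)"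
    by (rule SUP_upper) (use assms(1) in auto)
  then show ?thesis using assms(2) by (simp add: nonneg_infsum_complete)
qed

theorem proposition2:
  fixes M :: "('a, 'e::euclidean_space) riemannian"
    and A :: "'a set" and C1 :: real and F :: "('a \<times> real) set"
  assumes "riemannian_manifold M"
    and "Metric_space.mcomplete (points M) (rdist M)"
    and "Metric_space.mbounded (points M) (rdist M) A"
    and "1 \<le> C1"
    and "\<And>B. \<lbrakk>besicovitch_family M B; B \<subseteq> admissible_balls M A\<rbrakk> \<Longrightarrow> real (card B) \<le> C1"
    and "F \<subseteq> admissible_balls M A"
  shows "\<exists>F'\<subseteq>F. \<forall>y\<in>points M.
    (indicator (fst ` F) y :: ennreal) \<le> (\<Sum>\<^sub>\<infinity>(x, r)\<in>F'. indicator (rball M x r) y) \<and>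
    (\<Sum>\<^sub>\<infinity>(x, r)\<in>F'. indicator (rball M x r) y) \<le> ennreal C1 * C0 M A + 1"
proof -
  interpret riemannian_manifold M by fact
  define ball where "ball = (\<lambda>(x, r). rball M x r)"
  have fold: "(\<lambda>(x, r). indicator (rball M x r) y :: ennreal) = (\<lambda>i. indicator (ball i) y)" for y
    by (auto simp: ball_def)
  obtain z D where A: "A \<subseteq> rball M z D" using assms(3) unfolding mbounded_def by blast
  then have AM: "A \<subseteq> points M" using mcball_subset_mspace by blast
  have F: "x \<in> A" "x \<in> points M" "0 < r" if "(x, r) \<in> F" for x r
    using that assms(6) AM by (auto simp: admissible_balls_def)
  have "\<exists>F'\<subseteq>F. (\<forall>(x, r)\<in>F. \<exists>i\<in>F'. x \<in> ball i) \<and>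
    (\<forall>y I. finite I \<and> I \<subseteq> F' \<and> (\<forall>i\<in>I. y \<in> ball i) \<longrightarrow> of_nat (card I) \<le> ennreal C1 * C0 M A + 1)"
  proof (cases "\<exists>(x, r)\<in>F. 2 * D \<le> r")
    \<comment> \<open>If \<open>R_bound M A = \<infinity>\<close>, the radii may be unbounded and there is no top level.\<close>
    case True
    then obtain x r where x: "(x, r) \<in> F" "2 * D \<le> r" by blast
    \<comment> \<open>Points of \<open>A\<close> lie in \<open>rball M z D\<close>, so they are
      within \<open>2 * D\<close> of each other and this one ball covers \<open>A\<close>.\<close>
    have cov: "y \<in> ball (x, r)" if "y \<in> A" for y
    proof -
      have "x \<in> rball M z D" "y \<in> rball M z D" using subsetD[OF A] F(1)[OF x(1)] that by blast+
      then have "rdist M x y \<le> D + D"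
        using triangle[of x z y] by (auto simp: commute[of x z])
      then show ?thesis using x that AM F(2)[OF x(1)] by (auto simp: ball_def)
    qed
    show ?thesis
    proof (intro exI[of _ "{(x, r)}"] conjI allI impI)
      show "{(x, r)} \<subseteq> F" "\<forall>(y, s)\<in>F. \<exists>i\<in>{(x, r)}. y \<in> ball i" using x cov F by auto
      fix y I assume "finite I \<and> I \<subseteq> {(x, r)} \<and> (\<forall>i\<in>I. y \<in> ball i)"
      then have "card I \<le> 1" using card_mono[of "{(x, r)}" I] by simp
      then have "(of_nat (card I) :: ennreal) \<le> of_nat 1" by (rule of_nat_mono)
      also have "\<dots> \<le> ennreal C1 * C0 M A + 1" by simp
      finally show "of_nat (card I) \<le> ennreal C1 * C0 M A + 1" .
    qed
  next
    case False
    \<comment> \<open>With no such large ball, \<open>2 * D\<close> bounds all radii and is the top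
      of the dyadic scale.\<close>
    have "F \<subseteq> points M \<times> {0<..2 * D}" using F False by fastforce
    then obtain K where K: "K \<subseteq> F" "\<And>x r. (x, r) \<in> F \<Longrightarrow> \<exists>(y, s)\<in>K. rdist M y x \<le> s"
      "\<And>x r y s. \<lbrakk>(x, r) \<in> K; (y, s) \<in> K; (x, r) \<noteq> (y, s); r \<le> s\<rbrakk>
        \<Longrightarrow> r < rdist M x y \<and> (rdist M x y \<le> s \<longrightarrow> s \<le> 2 * r)"
      using greedy_ball_selection by blast
    show ?thesis
    proof (intro exI[of _ K] conjI allI impI)
      show "K \<subseteq> F" by fact
      show "\<forall>(x, r)\<in>F. \<exists>i\<in>K. x \<in> ball i"
      proof safe
        fix x r assume x: "(x, r) \<in> F"
        then obtain y s where y: "(y, s) \<in> K" "rdist M y x \<le> s" using K(2) by blast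
        then have "x \<in> ball (y, s)" using F(2)[OF x] F(2)[of y s] K(1) by (auto simp: ball_def)
        then show "\<exists>i\<in>K. x \<in> ball i" using y by blast
      qed
      fix y I assume I: "finite I \<and> I \<subseteq> K \<and> (\<forall>i\<in>I. y \<in> ball i)"
      have "of_nat (card I) \<le> ennreal C1 * C0 M A"
      proof (rule card_balls_at_point_le[of I A y])
        show "I \<subseteq> admissible_balls M A" using I K(1) assms(6) by blast
        show "y \<in> rball M x r" if "(x, r) \<in> I" for x r using I that by (auto simp: ball_def)
        show "r < rdist M x y \<and> (rdist M x y \<le> s \<longrightarrow> s \<le> 2 * r)"
          if "(x, r) \<in> I" "(y, s) \<in> I" "(x, r) \<noteq> (y, s)" "r \<le> s" for x r y s
          using K(3) I that by blast
      qed (use I AM assms(5) in auto)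
      then show "of_nat (card I) \<le> ennreal C1 * C0 M A + 1"
        by (rule order_trans) simp
    qed
  qed
  then obtain F' where F': "F' \<subseteq> F" "\<forall>(x, r)\<in>F. \<exists>i\<in>F'. x \<in> ball i"
    "\<forall>y I. finite I \<and> I \<subseteq> F' \<and> (\<forall>i\<in>I. y \<in> ball i) \<longrightarrow> of_nat (card I) \<le> ennreal C1 * C0 M A + 1"
    by (elim exE conjE)
  show ?thesis
    unfolding fold
  proof (intro exI[of _ F'] conjI ballI)
    fix y
    show "(indicator (fst ` F) y :: ennreal) \<le> (\<Sum>\<^sub>\<infinity>i\<in>F'. indicator (ball i) y)"
    proof (cases "y \<in> fst ` F")
      case True
      then obtain i where "i \<in> F'" "y \<in> ball i" using F'(2) by force
      then show ?thesis using infsum_indicator_ge_1[of i F' y ball] True by simp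
    qed simp
    show "(\<Sum>\<^sub>\<infinity>i\<in>F'. indicator (ball i) y) \<le> ennreal C1 * C0 M A + 1"
      by (rule infsum_indicator_le, rule F'(3)[rule_format]) blast
  qed (rule F'(1))
qed

end
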